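(* If $P$ is a polynomial of degree $N\in\mathbb N$, then there exist a polynomial $U$ of degree $\le N-1$ and a polynomial $H$ of degree $\le\sigma$ such that $$\mathfrak D_w[P]=\det\begin{pmatrix}P&\mathfrak C_w[P]\\ U&\mathfrak C_w[U]+H\end{pmatrix}.$$ Moreover, $\mathfrak D_w[P]$ is a polynomial of degree $\le N+\sigma$.
   Context: Semiclassical weight. $A$ is a monic polynomial with set of zeros $\mathbb A\subset\mathbb C$ (possibly empty), and $B$ is a polynomial (not assumed coprime to $A$). $\Delta=\Gamma_1\cup\dots\cup\Gamma_k$, where each $\Gamma_j$ is an oriented Jordan piecewise analytic arc joining a pair of points of $\mathbb A\cup\{\infty\}$ and containing no other point of $\mathbb A$ in its interior; the interiors of the $\Gamma_j$ are pairwise disjoint. Up to a normalization constant, define the (multivalued) analytic functions $$w(z)=\exp\left(\int^z\frac{B(t)}{A(t)}\,dt\right),\qquad v(z)=A(z)w(z),$$ with only possible singularities at $\mathbb A\cup\{\infty\}$, so that $w'/w=B/A$. The weight on $\Delta$, denoted by the same letter $w$, coincides on each $\Gamma_j$, up to a non-zero multiplicative constant, with the left boundary value $w_+$. It is assumed that $\int_\Delta|z|^m|w(z)||dz|<+\infty$ for $m=0,1,2,\dots$; as a consequence, $z^mv(z)=0$ (in the limit sense) at every endpoint of a subarc of $\Delta$, for all $m=0,1,2,\dots$. Put $\sigma=\max\{\deg(A)-2,\deg(B)-1\}$; it is assumed that $\sigma\ge0$. For a $w$-integrable function $f$ on $\Delta$, the weighted Cauchy transform is $\mathfrak C_w[f](z)=\int_\Delta\frac{f(t)w(t)}{t-z}\,dt$,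 $z\in\mathbb C\setminus\Delta$. For a polynomial $P$, with $q=\mathfrak C_w[P]/w$ (function of the second kind), $$\mathfrak D_w[P]:=\det\begin{pmatrix}P&\mathfrak C_w[P]\\ AP'&A(\mathfrak C_w[P])'-B\,\mathfrak C_w[P]\end{pmatrix}=v\,(Pq'-P'q),$$ a priori holomorphic in $\mathbb C\setminus\Delta$; stating that it is a polynomial means that it coincides on $\mathbb C\setminus\Delta$ with a polynomial. *)

theory Defs
  imports "HOL-Complex_Analysis.Complex_Analysis"
begin

section \<open>Arcs in the plane with endpoints in the extended plane\<close>

text \<open>
  An oriented arc is a function on the open unit interval, traversed in the direction of increasing
  parameter. An endpoint may be the point at infinity, so endpoints are limits at 0 and 1, and the
  values of the function outside the open unit interval are irrelevant.
\<close>

definition zeros :: "complex poly \<Rightarrow> complex set" where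
  "zeros A = {z. poly A z = 0}"

definition arc_interior :: "(real \<Rightarrow> complex) \<Rightarrow> complex set" where
  "arc_interior \<gamma> = \<gamma> ` {0<..<1}"

definition finite_ends :: "(real \<Rightarrow> complex) \<Rightarrow> complex set" where
  "finite_ends \<gamma> = {a. (\<gamma> \<longlongrightarrow> a) (at_right 0) \<or> (\<gamma> \<longlongrightarrow> a) (at_left 1)}"

definition arc_trace :: "(real \<Rightarrow> complex) \<Rightarrow> complex set" where
  "arc_trace \<gamma> = arc_interior \<gamma> \<union> finite_ends \<gamma>"

text \<open>
  Real analyticity of a complex-valued function on a real interval, endpoints included, is the
  existence of a holomorphic extension to a neighbourhood of the interval.
\<close>

definition regular_analytic_on :: "(real \<Rightarrow> complex) \<Rightarrow> real set \<Rightarrow> bool" where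
  "regular_analytic_on \<gamma> I \<longleftrightarrow>
     (\<exists>G. G analytic_on (complex_of_real ` I) \<and>
          (\<forall>x\<in>I. \<gamma> x = G (complex_of_real x) \<and> deriv G (complex_of_real x) \<noteq> 0))"

definition regular_point :: "(real \<Rightarrow> complex) \<Rightarrow> real \<Rightarrow> bool" where
  "regular_point \<gamma> s \<longleftrightarrow> (\<exists>a b. a < s \<and> s < b \<and> regular_analytic_on \<gamma> {a..b})"

text \<open>
  \<open>S\<close> is the set of corners. Pieces are analytic up to and including the corners; no smoothness is
  required at the endpoints of the arc itself, which may be at infinity. Injectivity concerns the
  open arc only, so that an arc from infinity to infinity (such as the real line) is included.
\<close>

definition jordan_piecewise_analytic_arc :: "(real \<Rightarrow> complex) \<Rightarrow> bool" where
  "jordan_piecewise_analytic_arc \<gamma> \<longleftrightarrow>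
     continuous_on {0<..<1} \<gamma> \<and> inj_on \<gamma> {0<..<1} \<and>
     (\<exists>S. finite S \<and>
          (\<forall>a b. 0 < a \<and> a < b \<and> b < 1 \<and> {a<..<b} \<inter> S = {} \<longrightarrow> regular_analytic_on \<gamma> {a..b}))"

definition joins_points_of :: "complex set \<Rightarrow> (real \<Rightarrow> complex) \<Rightarrow> bool" where
  "joins_points_of Z \<gamma> \<longleftrightarrow>
     (filterlim \<gamma> at_infinity (at_right 0) \<or> (\<exists>a\<in>Z. (\<gamma> \<longlongrightarrow> a) (at_right 0))) \<and>
     (filterlim \<gamma> at_infinity (at_left 1) \<or> (\<exists>a\<in>Z. (\<gamma> \<longlongrightarrow> a) (at_left 1)))"

definition admissible_arcs :: "complex poly \<Rightarrow> nat \<Rightarrow> (nat \<Rightarrow> real \<Rightarrow> complex) \<Rightarrow> bool" where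
  "admissible_arcs A k \<Gamma> \<longleftrightarrow>
     (\<forall>j\<in>{1..k}. jordan_piecewise_analytic_arc (\<Gamma> j) \<and>
                 joins_points_of (zeros A) (\<Gamma> j) \<and>
                 arc_interior (\<Gamma> j) \<inter> zeros A = {}) \<and>
     disjoint_family_on (\<lambda>j. arc_interior (\<Gamma> j)) {1..k}"

definition support :: "nat \<Rightarrow> (nat \<Rightarrow> real \<Rightarrow> complex) \<Rightarrow> complex set" where
  "support k \<Gamma> = (\<Union>j\<in>{1..k}. arc_trace (\<Gamma> j))"

section \<open>The semiclassical weight\<close>

text \<open>
  A single-valued branch, on a domain, of the multivalued function
  \<open>z \<mapsto> exp (\<integral>\<^sup>z B/A)\<close>; the normalization constant is the constant of the primitive \<open>F\<close>.
\<close>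

definition semiclassical_branch ::
  "complex poly \<Rightarrow> complex poly \<Rightarrow> complex set \<Rightarrow> (complex \<Rightarrow> complex) \<Rightarrow> bool" where
  "semiclassical_branch A B \<Omega> g \<longleftrightarrow>
     open \<Omega> \<and> connected \<Omega> \<and> \<Omega> \<inter> zeros A = {} \<and>
     (\<exists>F. \<forall>z\<in>\<Omega>. (F has_field_derivative poly B z / poly A z) (at z) \<and> g z = exp (F z))"

text \<open>
  Near a regular point the points to the left of the arc are \<open>\<gamma> x + \<epsilon> \<i> \<gamma>'(x)\<close> with small positive
  \<open>\<epsilon>\<close>. The set \<open>\<Omega>\<close> must contain the left side of the arc near \<open>\<gamma> s\<close>, and \<open>g\<close> tends to \<open>L\<close> when
  \<open>\<gamma> s\<close> is approached from that side.
\<close>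

definition left_point :: "(real \<Rightarrow> complex) \<Rightarrow> real \<times> real \<Rightarrow> complex" where
  "left_point \<gamma> = (\<lambda>(x, \<epsilon>). \<gamma> x + complex_of_real \<epsilon> * (\<i> * vector_derivative \<gamma> (at x)))"

definition left_boundary_value ::
  "complex set \<Rightarrow> (complex \<Rightarrow> complex) \<Rightarrow> (real \<Rightarrow> complex) \<Rightarrow> real \<Rightarrow> complex \<Rightarrow> bool" where
  "left_boundary_value \<Omega> g \<gamma> s L \<longleftrightarrow>
     (\<forall>\<^sub>F p in at (s, 0) within UNIV \<times> {0<..}. left_point \<gamma> p \<in> \<Omega>) \<and>
     ((\<lambda>p. g (left_point \<gamma> p)) \<longlongrightarrow> L) (at (s, 0) within UNIV \<times> {0<..})"

text \<open>
  At the finitely many corners, where there is no normal direction, the boundary value is the one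
  determined by continuity along the arc.
\<close>

definition semiclassical_weight_on ::
  "complex poly \<Rightarrow> complex poly \<Rightarrow> (real \<Rightarrow> complex) \<Rightarrow> (complex \<Rightarrow> complex) \<Rightarrow> bool" where
  "semiclassical_weight_on A B \<gamma> w \<longleftrightarrow>
     continuous_on {0<..<1} (\<lambda>s. w (\<gamma> s)) \<and>
     (\<exists>\<Omega> g c. semiclassical_branch A B \<Omega> g \<and> c \<noteq> 0 \<and>
        (\<forall>s\<in>{0<..<1}. regular_point \<gamma> s \<longrightarrow>
           (\<exists>L. left_boundary_value \<Omega> g \<gamma> s L \<and> w (\<gamma> s) = c * L)))"

definition finite_moments ::
  "nat \<Rightarrow> (nat \<Rightarrow> real \<Rightarrow> complex) \<Rightarrow> (complex \<Rightarrow> complex) \<Rightarrow> bool" where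
  "finite_moments k \<Gamma> w \<longleftrightarrow>
     (\<forall>m::nat. \<forall>j\<in>{1..k}.
        (\<lambda>s. norm (\<Gamma> j s) ^ m * norm (w (\<Gamma> j s)) * norm (vector_derivative (\<Gamma> j) (at s)))
          integrable_on {0<..<1})"

text \<open>The degree of the zero polynomial is 0 here; this does not affect \<open>\<sigma>\<close> when \<open>\<sigma> \<ge> 0\<close>.\<close>

definition class_index :: "complex poly \<Rightarrow> complex poly \<Rightarrow> int" where
  "class_index A B = max (int (degree A) - 2) (int (degree B) - 1)"

section \<open>Weighted Cauchy transform and the operator \<open>\<DD>\<^sub>w\<close>\<close>

text \<open>
  The integral in \<^const>\<open>contour_integral\<close> is a gauge integral in the parameter, so it does not
  depend on the values of the arc at 0 and 1 and it covers unbounded arcs.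
\<close>

definition weighted_cauchy ::
  "nat \<Rightarrow> (nat \<Rightarrow> real \<Rightarrow> complex) \<Rightarrow> (complex \<Rightarrow> complex) \<Rightarrow> (complex \<Rightarrow> complex) \<Rightarrow> complex \<Rightarrow> complex"
  where
  "weighted_cauchy k \<Gamma> w f z = (\<Sum>j\<in>{1..k}. contour_integral (\<Gamma> j) (\<lambda>t. f t * w t / (t - z)))"

definition det2 :: "complex \<Rightarrow> complex \<Rightarrow> complex \<Rightarrow> complex \<Rightarrow> complex" where
  "det2 a b c d = det (vector [vector [a, b], vector [c, d]] :: complex^2^2)"

definition D_op ::
  "complex poly \<Rightarrow> complex poly \<Rightarrow> nat \<Rightarrow> (nat \<Rightarrow> real \<Rightarrow> complex) \<Rightarrow> (complex \<Rightarrow> complex) \<Rightarrow>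
   complex poly \<Rightarrow> complex \<Rightarrow> complex" where
  "D_op A B k \<Gamma> w P z =
     (let C = weighted_cauchy k \<Gamma> w (poly P) in
      det2 (poly P z)                        (C z)
           (poly A z * poly (pderiv P) z)    (poly A z * deriv C z - poly B z * C z))"

end

theory Submission
  imports Defs
begin

text \<open>
  Write \<open>C f\<close> for the weighted Cauchy transform of a polynomial \<open>f\<close>. Two facts about it carry the
  proof. First, multiplication by a polynomial almost commutes with \<open>C\<close>: since
  \<open>(E(t) - E(z)) / (t - z)\<close> is a polynomial, \<open>C (E f) = E C f + Q\<close> with a polynomial \<open>Q\<close> of degree
  less than that of \<open>E\<close> (lemma \<open>C_mult\<close>). Secondly, integration by parts turns the derivative back
  into a Cauchy transform, \<open>(C (A f))' = C (A f' + (A' + B) f)\<close> (lemma \<open>cauchy_deriv_A\<close>), because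
  \<open>v = A w\<close> satisfies \<open>v' = (A' + B) w\<close> and vanishes, times any polynomial, at the ends of the arcs.

  Applied to \<open>f = P\<close>, these give \<open>A (C P)' - B C P = C (A P') + polynomial\<close>. Writing \<open>A P' = E P + U\<close>
  with \<open>deg U < deg P\<close>, the second row of the determinant that defines \<open>D_op\<close> becomes \<open>E\<close> times the
  first row plus \<open>(U, C U + H)\<close>, which is the asserted identity (lemma \<open>D_decomposition\<close>). Finally
  \<open>P C U\<close> and \<open>U C P\<close> both agree with \<open>C (P U)\<close> up to a polynomial of degree less than \<open>deg P\<close>, so the
  determinant \<open>P (C U + H) - U C P\<close> is a polynomial, whose degree is governed by \<open>P H\<close>.

  The analytic work is to justify the integration by parts. The weight is given by boundary values
  from the left of a branch of \<open>exp (\<integral> B/A)\<close>; near each regular point of an arc such a branch is a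
  constant multiple of one that is holomorphic on both sides of the arc, which yields
  \<open>w'/w = B/A\<close> along the arc (lemma \<open>weight_derivative\<close>). Integrability of the moments makes the
  derivative of \<open>f v\<close> integrable, so \<open>f v\<close> has limits at both ends. A nonzero limit is impossible:
  at infinity because \<open>t f v\<close> has a finite limit too, and at a zero \<open>a\<close> of \<open>A\<close> because then \<open>|w|\<close>
  would be at least of the size of \<open>1/|t - a|\<close>, which is not integrable along an arc that ends at
  \<open>a\<close> (lemma \<open>v_vanishes\<close>).
\<close>

section \<open>Calculus on an open interval with finitely many exceptional points\<close>

lemma antiderivative_open_interval:
  fixes u :: "real \<Rightarrow> 'a::banach"
  assumes S: "finite S" and cont: "continuous_on {p<..<q} u"
    and der: "\<And>x. x \<in> {p<..<q} - S \<Longrightarrow> (u has_vector_derivative u' x) (at x)"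
    and int: "u' integrable_on {p<..<q}"
  obtains c where "\<And>x. x \<in> {p<..<q} \<Longrightarrow> u x = c + integral {p..x} u'"
proof
  define m where "m = (p + q) / 2"
  have int': "u' integrable_on {p..q}"
    using int by (simp add: integrable_on_open_interval_real)
  have step: "u y - u x = integral {p..y} u' - integral {p..x} u'"
    if "p < x" "x \<le> y" "y < q" for x y
  proof -
    have "(u' has_integral u y - u x) {x..y}"
      using that
      by (intro fundamental_theorem_of_calculus_interior_strong[OF S])
        (auto intro!: der intro: continuous_on_subset[OF cont])
    moreover have "integral {p..x} u' + integral {x..y} u' = integral {p..y} u'"
      using that by (intro Henstock_Kurzweil_Integration.integral_combine)
        (auto intro: integrable_subinterval_real[OF int'])
    ultimately show ?thesis by (simp add: integral_unique algebra_simps)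
  qed
  show "u x = (u m - integral {p..m} u') + integral {p..x} u'" if "x \<in> {p<..<q}" for x
  proof (cases "x \<le> m")
    case True
    show ?thesis using step[of x m] True that unfolding m_def by (simp add: algebra_simps)
  next
    case False
    show ?thesis using step[of m x] False that unfolding m_def by (simp add: algebra_simps)
  qed
qed

text \<open>
  This is how absolute integrability controls the behaviour at the ends of an arc: the primitive is
  continuous up to both endpoints of the interval even though \<open>u\<close> is only known inside.
\<close>

lemma integrable_derivative_limits:
  fixes u :: "real \<Rightarrow> 'a::banach"
  assumes "p < q" and "finite S" and "continuous_on {p<..<q} u"
    and "\<And>x. x \<in> {p<..<q} - S \<Longrightarrow> (u has_vector_derivative u' x) (at x)"
    and "u' integrable_on {p<..<q}"
  shows "\<exists>l r. (u \<longlongrightarrow> l) (at_right p) \<and> (u \<longlongrightarrow> r) (at_left q) \<and>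
    (u' has_integral r - l) {p<..<q} \<and> bounded (u ` {p<..<q})"
proof -
  from antiderivative_open_interval[OF assms(2-5)] obtain c
    where c: "\<And>x. x \<in> {p<..<q} \<Longrightarrow> u x = c + integral {p..x} u'" by blast
  define J where "J x = c + integral {p..x} u'" for x
  have int': "u' integrable_on {p..q}"
    using assms(5) by (simp add: integrable_on_open_interval_real)
  have contJ: "continuous_on {p..q} J"
    unfolding J_def by (intro continuous_intros indefinite_integral_continuous_1 int')
  have "(J \<longlongrightarrow> J p) (at_right p)"
    using contJ \<open>p < q\<close> unfolding continuous_on_def
    by (metis at_within_Icc_at_right atLeastAtMost_iff less_eq_real_def)
  moreover have "eventually (\<lambda>x. J x = u x) (at_right p)"
    using eventually_at_right_real[OF \<open>p < q\<close>] by eventually_elim (auto simp: J_def c)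
  ultimately have l: "(u \<longlongrightarrow> J p) (at_right p)" by (metis tendsto_cong)
  have "(J \<longlongrightarrow> J q) (at_left q)"
    using contJ \<open>p < q\<close> unfolding continuous_on_def
    by (metis at_within_Icc_at_left atLeastAtMost_iff less_eq_real_def)
  moreover have "eventually (\<lambda>x. J x = u x) (at_left q)"
    using eventually_at_left_real[OF \<open>p < q\<close>] by eventually_elim (auto simp: J_def c)
  ultimately have r: "(u \<longlongrightarrow> J q) (at_left q)" by (metis tendsto_cong)
  have "(u' has_integral integral {p<..<q} u') {p<..<q}"
    using assms(5) by blast
  moreover have "integral {p<..<q} u' = J q - J p"
    by (simp add: J_def integral_open_interval_real)
  ultimately have i: "(u' has_integral J q - J p) {p<..<q}" by simp
  have "bounded (J ` {p..q})"
    using compact_continuous_image[OF contJ compact_Icc] by (rule compact_imp_bounded)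
  moreover have "u ` {p<..<q} \<subseteq> J ` {p..q}" using c by (force simp: J_def)
  ultimately have "bounded (u ` {p<..<q})" by (rule bounded_subset)
  with l r i show ?thesis by blast
qed

text \<open>
  Continuity off a finite set supplies the measurability, so integrability of a gauge integrand
  follows from a pointwise bound.
\<close>

lemma dominated_continuous_absolutely_integrable:
  fixes h :: "real \<Rightarrow> 'b::euclidean_space"
  assumes S: "finite S" and cont: "continuous_on ({p<..<q} - S) h"
    and g: "g integrable_on {p<..<q}"
    and le: "\<And>x. x \<in> {p<..<q} - S \<Longrightarrow> norm (h x) \<le> g x"
  shows "h absolutely_integrable_on {p<..<q}"
proof -
  have neg: "negligible {x \<in> {p<..<q} - ({p<..<q} - S). f x \<noteq> 0}"
     "negligible {x \<in> {p<..<q} - S - {p<..<q}. f x \<noteq> 0}" for f :: "real \<Rightarrow> 'z::zero"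
    using S by (auto intro!: negligible_finite intro: finite_subset[of _ S])
  have "open ({p<..<q} - S)" using S by (simp add: open_Diff finite_imp_closed)
  then have sets: "{p<..<q} - S \<in> sets lebesgue" by simp
  have "h absolutely_integrable_on ({p<..<q} - S)"
    using continuous_imp_measurable_on_sets_lebesgue[OF cont sets] sets
    by (rule measurable_bounded_by_integrable_imp_absolutely_integrable)
       (use integrable_spike_set[OF g neg] le in auto)
  then show ?thesis
    using absolutely_integrable_spike_set_eq[OF neg, of h] by simp
qed

lemma has_real_derivative_inner_self:
  fixes h :: "real \<Rightarrow> 'a::real_inner"
  assumes "(h has_vector_derivative h') (at s)"
  shows "((\<lambda>s. h s \<bullet> h s) has_real_derivative 2 * (h s \<bullet> h')) (at s)"
  using has_derivative_inner[OF assms[unfolded has_vector_derivative_def]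
      assms[unfolded has_vector_derivative_def]]
  unfolding has_field_derivative_def
  by (rule has_derivative_eq_rhs) (auto simp: fun_eq_iff inner_commute)

section \<open>The differential equation of the weight along an arc\<close>

lemma regular_analytic_on_derivative:
  assumes "regular_analytic_on \<gamma> {a..b}"
  shows "\<And>x. x \<in> {a<..<b} \<Longrightarrow> (\<gamma> has_vector_derivative vector_derivative \<gamma> (at x)) (at x)"
    and "continuous_on {a<..<b} (\<lambda>x. vector_derivative \<gamma> (at x))"
proof -
  obtain G where G: "G analytic_on complex_of_real ` {a..b}"
    and eq: "\<And>x. x \<in> {a..b} \<Longrightarrow> \<gamma> x = G (complex_of_real x)"
    using assms unfolding regular_analytic_on_def by blast
  have der: "(\<gamma> has_vector_derivative deriv G (of_real x)) (at x)" if "x \<in> {a<..<b}" for x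
  proof -
    have "G field_differentiable at (of_real x)"
      using G that analytic_on_imp_differentiable_at by fastforce
    then have "((\<lambda>x. G (of_real x)) has_vector_derivative deriv G (of_real x)) (at x)"
      by (intro has_vector_derivative_real_field) (simp add: field_differentiable_derivI)
    then show ?thesis
      by (rule has_vector_derivative_transform_within_open[of _ _ _ "{a<..<b}"])
         (use that eq in auto)
  qed
  then show "(\<gamma> has_vector_derivative vector_derivative \<gamma> (at x)) (at x)"
    if "x \<in> {a<..<b}" for x
    using that vector_derivative_at by metis
  have "continuous_on (complex_of_real ` {a..b}) (deriv G)"
    using G analytic_deriv analytic_imp_holomorphic holomorphic_on_imp_continuous_on by blast
  then have "continuous_on {a<..<b} (\<lambda>x. deriv G (of_real x))"
    by (rule continuous_on_compose2) (auto intro!: continuous_intros)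
  then show "continuous_on {a<..<b} (\<lambda>x. vector_derivative \<gamma> (at x))"
    by (rule continuous_on_eq) (simp add: vector_derivative_at[OF der])
qed

text \<open>
  Two primitives of \<open>B/A\<close> differ by a constant on each connected component. As \<open>\<Omega> \<inter> V\<close> need not
  be connected, the constant depends on the component, and hence on the connected set \<open>X\<close>.
\<close>

lemma semiclassical_branch_local:
  assumes br: "semiclassical_branch A B \<Omega> g"
    and prim: "\<And>z. z \<in> V \<Longrightarrow> (F\<^sub>0 has_field_derivative poly B z / poly A z) (at z)"
    and "open V" and "connected X" and "X \<subseteq> \<Omega> \<inter> V"
  shows "\<exists>K. \<forall>z\<in>X. g z = K * exp (F\<^sub>0 z)"
proof (cases "X = {}")
  case False
  then obtain z\<^sub>0 where z0: "z\<^sub>0 \<in> X" by blast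
  obtain F where F: "\<And>z. z \<in> \<Omega> \<Longrightarrow> (F has_field_derivative poly B z / poly A z) (at z)"
      "\<And>z. z \<in> \<Omega> \<Longrightarrow> g z = exp (F z)" and "open \<Omega>"
    using br unfolding semiclassical_branch_def by blast
  define Y where "Y = connected_component_set (\<Omega> \<inter> V) z\<^sub>0"
  have sub: "Y \<subseteq> \<Omega> \<inter> V" unfolding Y_def by (rule connected_component_subset)
  have "X \<subseteq> Y" unfolding Y_def using z0 assms by (intro connected_component_maximal) auto
  have "open Y" unfolding Y_def
    using \<open>open \<Omega>\<close> \<open>open V\<close> by (intro open_connected_component open_Int)
  have der: "((\<lambda>z. F z - F\<^sub>0 z) has_field_derivative 0) (at z)" if "z \<in> Y" for z
    using DERIV_diff[OF F(1) prim, of z] that sub by auto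
  then have "continuous_on Y (\<lambda>z. F z - F\<^sub>0 z)"
    by (meson DERIV_isCont continuous_at_imp_continuous_on)
  with DERIV_zero_connected_constant[of Y "{}" "\<lambda>z. F z - F\<^sub>0 z"] \<open>open Y\<close> der
  obtain c where c: "\<And>z. z \<in> Y \<Longrightarrow> F z - F\<^sub>0 z = c"
    unfolding Y_def by auto
  have "g z = exp c * exp (F\<^sub>0 z)" if "z \<in> X" for z
  proof -
    have "z \<in> Y" "z \<in> \<Omega>" using that \<open>X \<subseteq> Y\<close> sub by auto
    then have "F z = c + F\<^sub>0 z" "g z = exp (F z)" using c[of z] F(2)[of z] by (auto simp: algebra_simps)
    then show ?thesis by (simp add: exp_add)
  qed
  then show ?thesis by blast
qed simp

text \<open>
  The left side of a short analytic piece of the arc is the image of a rectangle under a continuous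
  map, hence connected, so there \<open>g\<close> is a constant multiple of \<open>exp F\<^sub>0\<close> for a primitive \<open>F\<^sub>0\<close> of
  \<open>B/A\<close> that is holomorphic in a full disc about \<open>\<gamma> s\<close>. Letting the distance to the arc tend to 0
  shows that the boundary values are the restriction of \<open>K exp F\<^sub>0\<close> to the arc, although the branch
  \<open>g\<close> itself may live on one side only.
\<close>

lemma left_boundary_value_local:
  assumes br: "semiclassical_branch A B \<Omega> g"
    and reg: "regular_analytic_on \<gamma> {a..b}" and s: "a < s" "s < b"
    and nz: "poly A (\<gamma> s) \<noteq> 0"
    and lbv: "\<And>x. x \<in> {a<..<b} \<Longrightarrow> left_boundary_value \<Omega> g \<gamma> x (L x)"
  shows "\<exists>e>0. \<exists>K F\<^sub>0. {s-e<..<s+e} \<subseteq> {a<..<b} \<and>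
    (F\<^sub>0 has_field_derivative poly B (\<gamma> s) / poly A (\<gamma> s)) (at (\<gamma> s)) \<and>
    (\<forall>x\<in>{s-e<..<s+e}. L x = K * exp (F\<^sub>0 (\<gamma> x)))"
proof -
  note d = regular_analytic_on_derivative[OF reg]
  have "open (- {z. poly A z = 0})"
    using nz by (intro open_Compl finite_imp_closed poly_roots_finite) auto
  then obtain r where r: "r > 0" "ball (\<gamma> s) r \<subseteq> - {z. poly A z = 0}"
    using nz by (metis (mono_tags, lifting) Compl_iff mem_Collect_eq openE)
  define V where "V = ball (\<gamma> s) r"
  have nzV: "poly A z \<noteq> 0" if "z \<in> V" for z using r that by (auto simp: V_def)
  have hol: "(\<lambda>z. poly B z / poly A z) holomorphic_on V"
    using nzV by (intro holomorphic_intros) auto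
  obtain F\<^sub>0 where F0: "\<And>z. z \<in> V \<Longrightarrow> (F\<^sub>0 has_field_derivative poly B z / poly A z) (at z)"
    using holomorphic_convex_primitive'[OF _ _ hol] unfolding V_def
    by (auto simp: at_within_open[OF _ open_ball])
  have contg: "continuous_on {a<..<b} \<gamma>"
    using d(1) by (meson continuous_at_imp_continuous_on has_vector_derivative_continuous)
  have clp: "continuous_on ({a<..<b} \<times> UNIV) (left_point \<gamma>)"
    unfolding left_point_def case_prod_beta
    by (intro continuous_intros continuous_on_compose2[OF contg] continuous_on_compose2[OF d(2)]) auto
  have isc: "isCont (left_point \<gamma>) (x, y)" if "x \<in> {a<..<b}" for x y
    using clp that by (simp add: continuous_on_eq_continuous_at open_Times)
  have lp0: "left_point \<gamma> (x, 0) = \<gamma> x" for x by (simp add: left_point_def)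
  have "\<forall>\<^sub>F p in nhds (s, 0). left_point \<gamma> p \<in> V \<and> p \<in> {a<..<b} \<times> UNIV"
  proof (rule eventually_conj)
    show "\<forall>\<^sub>F p in nhds (s, 0). left_point \<gamma> p \<in> V"
    proof -
      have "(left_point \<gamma> \<longlongrightarrow> left_point \<gamma> (s, 0)) (nhds (s, 0))"
        using isc[of s 0] s by (simp add: isCont_def tendsto_at_iff_tendsto_nhds)
      from topological_tendstoD[OF this, of V] show ?thesis
        using r(1) by (simp add: V_def lp0)
    qed
    show "\<forall>\<^sub>F p in nhds (s, 0::real). p \<in> {a<..<b} \<times> UNIV"
      using s by (intro eventually_nhds_in_open) (auto simp: open_Times)
  qed
  then obtain e1 where e1: "e1 > 0"
      "\<And>p. dist p (s, 0) < e1 \<Longrightarrow> left_point \<gamma> p \<in> V \<and> p \<in> {a<..<b} \<times> UNIV"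
    unfolding eventually_nhds_metric by blast
  have "\<forall>\<^sub>F p in at (s, 0) within UNIV \<times> {0<..}. left_point \<gamma> p \<in> \<Omega>"
    using lbv[of s] s unfolding left_boundary_value_def by auto
  then obtain e2 where e2: "e2 > 0"
      "\<And>p. p \<in> UNIV \<times> {0<..} \<Longrightarrow> p \<noteq> (s, 0) \<Longrightarrow> dist p (s, 0) < e2 \<Longrightarrow> left_point \<gamma> p \<in> \<Omega>"
    unfolding eventually_at by blast
  \<comment> \<open>Half the radius, because the square of half-width \<open>e\<close> lies in the disc of radius \<open>2 e\<close>.\<close>
  define e where "e = min e1 e2 / 2"
  have "e > 0" using e1 e2 by (simp add: e_def)
  have dist: "dist (x, y) (s, 0) < min e1 e2" if "\<bar>x - s\<bar> < e" "\<bar>y\<bar> < e" for x y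
  proof -
    have "dist (x, y) (s, 0) \<le> \<bar>x - s\<bar> + \<bar>y\<bar>"
      by (simp add: dist_Pair_Pair dist_real_def sqrt_sum_squares_le_sum_abs)
    with that show ?thesis by (simp add: e_def)
  qed
  define Q where "Q = {s-e<..<s+e} \<times> {0<..<e}"
  have Qp: "left_point \<gamma> p \<in> \<Omega> \<inter> V" "p \<in> {a<..<b} \<times> UNIV" if "p \<in> Q" for p
  proof -
    have "\<bar>fst p - s\<bar> < e" "\<bar>snd p\<bar> < e" using that by (auto simp: Q_def)
    from dist[OF this] that
    have *: "dist p (s, 0) < min e1 e2" "p \<in> UNIV \<times> {0<..}" "p \<noteq> (s, 0)"
      by (auto simp: Q_def)
    show "left_point \<gamma> p \<in> \<Omega> \<inter> V" "p \<in> {a<..<b} \<times> UNIV"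
      using e1(2)[of p] e2(2)[of p] * by auto
  qed
  then have Qsub: "left_point \<gamma> ` Q \<subseteq> \<Omega> \<inter> V" "Q \<subseteq> {a<..<b} \<times> UNIV"
    by blast+
  have "connected Q" unfolding Q_def by (intro connected_Times connected_Ioo)
  then have conn: "connected (left_point \<gamma> ` Q)"
    using continuous_on_subset[OF clp Qsub(2)] by (intro connected_continuous_image)
  have "open V" by (simp add: V_def)
  obtain K where K: "\<And>z. z \<in> left_point \<gamma> ` Q \<Longrightarrow> g z = K * exp (F\<^sub>0 z)"
    using semiclassical_branch_local[OF br F0 \<open>open V\<close> conn Qsub(1)] by blast
  have main: "L x = K * exp (F\<^sub>0 (\<gamma> x))" if x: "\<bar>x - s\<bar> < e" for x
  proof -
    let ?F = "at (x, 0::real) within UNIV \<times> {0<..}"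
    have xV: "\<gamma> x \<in> V" and xab: "x \<in> {a<..<b}"
      using e1(2)[of "(x, 0)"] dist[of x 0] x \<open>e > 0\<close> by (auto simp: lp0)
    have "UNIV \<times> {0<..} - {(x, 0)} = (UNIV::real set) \<times> {0::real<..}" by auto
    then have nt: "?F \<noteq> bot" by (simp add: at_within_eq_bot_iff closure_Times)
    have ev: "\<forall>\<^sub>F p in ?F. p \<in> Q"
    proof -
      have "\<forall>\<^sub>F p in ?F. p \<in> {s-e<..<s+e} \<times> {-e<..<e}"
        using x \<open>e > 0\<close> 
        by (intro eventually_at_in_open'[THEN filter_leD[OF at_le, OF subset_UNIV]])
           (auto simp: open_Times)
      moreover have "\<forall>\<^sub>F p in ?F. p \<in> UNIV \<times> {0<..}"
        by (simp add: eventually_at_filter)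
      ultimately show ?thesis by eventually_elim (auto simp: Q_def)
    qed
    have lim1: "((\<lambda>p. g (left_point \<gamma> p)) \<longlongrightarrow> L x) ?F"
      using lbv[OF xab] by (simp add: left_boundary_value_def)
    have "(left_point \<gamma> \<longlongrightarrow> \<gamma> x) ?F"
      using isc[OF xab, of 0] unfolding isCont_def lp0 by (rule tendsto_within_subset) auto
    moreover have "isCont F\<^sub>0 (\<gamma> x)" using F0[OF xV] by (rule DERIV_isCont)
    ultimately have "((\<lambda>p. K * exp (F\<^sub>0 (left_point \<gamma> p))) \<longlongrightarrow> K * exp (F\<^sub>0 (\<gamma> x))) ?F"
      by (intro tendsto_intros isCont_tendsto_compose[of _ F\<^sub>0])
    moreover have "\<forall>\<^sub>F p in ?F. K * exp (F\<^sub>0 (left_point \<gamma> p)) = g (left_point \<gamma> p)"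
      using ev by eventually_elim (use K in auto)
    ultimately have "((\<lambda>p. g (left_point \<gamma> p)) \<longlongrightarrow> K * exp (F\<^sub>0 (\<gamma> x))) ?F"
      by (rule Lim_transform_eventually)
    with lim1 nt show ?thesis by (metis tendsto_unique)
  qed
  have "{s-e<..<s+e} \<subseteq> {a<..<b}"
  proof
    fix x assume "x \<in> {s-e<..<s+e}"
    then show "x \<in> {a<..<b}"
      using e1(2)[of "(x, 0)"] dist[of x 0] \<open>e > 0\<close> by auto
  qed
  moreover have "\<forall>x\<in>{s-e<..<s+e}. L x = K * exp (F\<^sub>0 (\<gamma> x))"
    using main by (auto simp: abs_less_iff)
  moreover have "\<gamma> s \<in> V" using r(1) by (simp add: V_def)
  ultimately show ?thesis using \<open>e > 0\<close> F0 by blast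
qed

text \<open>
  Along the arc the weight satisfies \<open>w'/w = B/A\<close>: by the previous lemma it is locally a constant
  multiple of \<open>exp F\<^sub>0\<close> with \<open>F\<^sub>0' = B/A\<close>.
\<close>

lemma weight_derivative:
  assumes wt: "semiclassical_weight_on A B \<gamma> w"
    and reg: "regular_analytic_on \<gamma> {a..b}" and s: "a < s" "s < b" and ab: "{a<..<b} \<subseteq> {0<..<1}"
    and nz: "poly A (\<gamma> s) \<noteq> 0"
  shows "((\<lambda>x. w (\<gamma> x)) has_vector_derivative
            poly B (\<gamma> s) / poly A (\<gamma> s) * vector_derivative \<gamma> (at s) * w (\<gamma> s)) (at s)"
proof -
  obtain \<Omega> g c where br: "semiclassical_branch A B \<Omega> g" and
    lb: "\<And>x. x \<in> {0<..<1} \<Longrightarrow> regular_point \<gamma> x \<Longrightarrow>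
           \<exists>L. left_boundary_value \<Omega> g \<gamma> x L \<and> w (\<gamma> x) = c * L"
    using wt unfolding semiclassical_weight_on_def by blast
  have "regular_point \<gamma> x" if "x \<in> {a<..<b}" for x
    using reg that unfolding regular_point_def by auto
  then have "\<exists>L. left_boundary_value \<Omega> g \<gamma> x L \<and> w (\<gamma> x) = c * L" if "x \<in> {a<..<b}" for x
    using lb[of x] ab that by blast
  then obtain L where L: "\<And>x. x \<in> {a<..<b} \<Longrightarrow> left_boundary_value \<Omega> g \<gamma> x (L x)"
      "\<And>x. x \<in> {a<..<b} \<Longrightarrow> w (\<gamma> x) = c * L x" by metis
  obtain e F\<^sub>0 K where e: "e > 0" "{s-e<..<s+e} \<subseteq> {a<..<b}"
    and F0: "(F\<^sub>0 has_field_derivative poly B (\<gamma> s) / poly A (\<gamma> s)) (at (\<gamma> s))"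
    and LK: "\<And>x. x \<in> {s-e<..<s+e} \<Longrightarrow> L x = K * exp (F\<^sub>0 (\<gamma> x))"
    using left_boundary_value_local[OF br reg s nz, of L] L(1) by metis
  have eq: "c * (K * exp (F\<^sub>0 (\<gamma> x))) = w (\<gamma> x)" if "x \<in> {s-e<..<s+e}" for x
    using L(2)[of x] LK[of x] e(2) that by auto
  have ws: "w (\<gamma> s) = c * (K * exp (F\<^sub>0 (\<gamma> s)))" using eq[of s] e(1) by simp
  have "((\<lambda>z. c * (K * exp (F\<^sub>0 z))) has_field_derivative
      poly B (\<gamma> s) / poly A (\<gamma> s) * w (\<gamma> s)) (at (\<gamma> s))"
    unfolding ws by (auto intro!: derivative_eq_intros F0 simp: mult_ac)
  from field_vector_diff_chain_at[OF regular_analytic_on_derivative(1)[OF reg, of s] this]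
  have "((\<lambda>x. c * (K * exp (F\<^sub>0 (\<gamma> x)))) has_vector_derivative
      poly B (\<gamma> s) / poly A (\<gamma> s) * vector_derivative \<gamma> (at s) * w (\<gamma> s)) (at s)"
    using s by (simp add: o_def mult_ac)
  then show ?thesis
    by (rule has_vector_derivative_transform_within_open[of _ _ _ "{s-e<..<s+e}"])
       (use e(1) eq in auto)
qed

section \<open>Weighted integrals over a single arc\<close>

text \<open>
  The data of a single arc in the parameter \<open>s\<close>: the arc, its tangent \<open>\<gamma>'\<close>, the weight \<open>W\<close> read
  along the arc, and the set \<open>S\<close> of corners. The boundary values and the branch of the weight enter
  only through the differential equation \<open>W' = (B/A)(\<gamma>) \<gamma>' W\<close> off \<open>S\<close>.
\<close>

locale weighted_arc =
  fixes A B :: "complex poly" and \<gamma> \<gamma>' W :: "real \<Rightarrow> complex" and S :: "real set"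
  assumes finite_corners: "finite S"
    and cont_arc: "continuous_on {0<..<1} \<gamma>"
    and cont_weight: "continuous_on {0<..<1} W"
    and cont_tangent: "continuous_on ({0<..<1} - S) \<gamma>'"
    and arc_derivative: "\<And>s. s \<in> {0<..<1} - S \<Longrightarrow> (\<gamma> has_vector_derivative \<gamma>' s) (at s)"
    and weight_ode: "\<And>s. s \<in> {0<..<1} - S \<Longrightarrow>
          (W has_vector_derivative poly B (\<gamma> s) / poly A (\<gamma> s) * \<gamma>' s * W s) (at s)"
    and avoids_zeros: "\<And>s. s \<in> {0<..<1} \<Longrightarrow> poly A (\<gamma> s) \<noteq> 0"
    and moments: "\<And>m. (\<lambda>s. norm (\<gamma> s) ^ m * norm (W s) * norm (\<gamma>' s)) integrable_on {0<..<1}"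
    and ends: "\<And>F. F \<in> {at_right 0, at_left 1} \<Longrightarrow>
          filterlim \<gamma> at_infinity F \<or> (\<exists>a. poly A a = 0 \<and> (\<gamma> \<longlongrightarrow> a) F)"
begin

text \<open>
  Positive distance to the arc is what the estimates use, and unlike avoidance of the trace it is
  visibly an open condition.
\<close>

definition away :: "complex \<Rightarrow> bool" where
  "away z \<longleftrightarrow> (\<exists>d>0. \<forall>s\<in>{0<..<1}. d \<le> norm (\<gamma> s - z))"

definition arc_integral :: "(real \<Rightarrow> complex) \<Rightarrow> complex" where
  "arc_integral \<psi> = integral {0<..<1} (\<lambda>s. \<psi> s * (W s * \<gamma>' s))"

definition cauchy :: "complex poly \<Rightarrow> complex \<Rightarrow> complex" where
  "cauchy f z = arc_integral (\<lambda>s. poly f (\<gamma> s) / (\<gamma> s - z))"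

definition cauchy_deriv :: "complex poly \<Rightarrow> complex \<Rightarrow> complex" where
  "cauchy_deriv f z = arc_integral (\<lambda>s. poly f (\<gamma> s) / (\<gamma> s - z)\<^sup>2)"

lemma cont_poly [continuous_intros]: "continuous_on {0<..<1} (\<lambda>s. poly f (\<gamma> s))"
  by (intro continuous_on_compose2[OF _ cont_arc, of UNIV "poly f"] continuous_intros) auto

text \<open>
  The triangle inequality reduces a polynomial to its monomials, that is, to the moments.
\<close>

lemma poly_dominated:
  "(\<lambda>s. norm (poly f (\<gamma> s)) * norm (W s * \<gamma>' s)) integrable_on {0<..<1}"
proof -
  let ?g = "\<lambda>s. \<Sum>i\<le>degree f. norm (coeff f i) * (norm (\<gamma> s) ^ i * norm (W s) * norm (\<gamma>' s))"
  have "?g integrable_on {0<..<1}"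
    by (intro integrable_sum integrable_on_mult_right moments) auto
  moreover have "continuous_on ({0<..<1} - S) (\<lambda>s. norm (poly f (\<gamma> s)) * norm (W s * \<gamma>' s))"
    by (intro continuous_intros cont_tangent continuous_on_subset[OF cont_weight]
        continuous_on_subset[OF cont_poly]) auto
  moreover have "norm (norm (poly f (\<gamma> s)) * norm (W s * \<gamma>' s)) \<le> ?g s" for s
  proof -
    have "norm (poly f (\<gamma> s)) \<le> (\<Sum>i\<le>degree f. norm (coeff f i) * norm (\<gamma> s) ^ i)"
      unfolding poly_altdef by (rule order_trans[OF norm_sum]) (simp add: norm_mult norm_power)
    from mult_right_mono[OF this, of "norm (W s * \<gamma>' s)"] show ?thesis
      by (simp add: sum_distrib_left sum_distrib_right norm_mult mult_ac)
  qed
  ultimately have "(\<lambda>s. norm (poly f (\<gamma> s)) * norm (W s * \<gamma>' s)) absolutely_integrable_on {0<..<1}"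
    using dominated_continuous_absolutely_integrable[OF finite_corners] by blast
  then show ?thesis by (rule set_lebesgue_integral_eq_integral(1))
qed

lemma integrable_if_poly_bounded:
  assumes "continuous_on {0<..<1} \<psi>"
    and "\<And>s. s \<in> {0<..<1} \<Longrightarrow> norm (\<psi> s) \<le> C * norm (poly f (\<gamma> s))"
  shows "(\<lambda>s. \<psi> s * (W s * \<gamma>' s)) integrable_on {0<..<1}"
proof -
  have "(\<lambda>s. \<psi> s * (W s * \<gamma>' s)) absolutely_integrable_on {0<..<1}"
  proof (rule dominated_continuous_absolutely_integrable[OF finite_corners])
    show "continuous_on ({0<..<1} - S) (\<lambda>s. \<psi> s * (W s * \<gamma>' s))"
      by (intro continuous_intros cont_tangent continuous_on_subset[OF cont_weight]
        continuous_on_subset[OF assms(1)]) auto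
    show "(\<lambda>s. C * (norm (poly f (\<gamma> s)) * norm (W s * \<gamma>' s))) integrable_on {0<..<1}"
      by (intro integrable_on_mult_right poly_dominated)
    show "norm (\<psi> s * (W s * \<gamma>' s)) \<le> C * (norm (poly f (\<gamma> s)) * norm (W s * \<gamma>' s))"
      if "s \<in> {0<..<1} - S" for s
      using mult_right_mono[OF assms(2)[of s], of "norm (W s * \<gamma>' s)"] that
      by (simp add: norm_mult mult_ac)
  qed
  then show ?thesis by (rule set_lebesgue_integral_eq_integral(1))
qed

lemma poly_integrable: "(\<lambda>s. poly f (\<gamma> s) * (W s * \<gamma>' s)) integrable_on {0<..<1}"
  by (rule integrable_if_poly_bounded[where C = 1 and f = f]) (auto intro: cont_poly)

text \<open>
  Away from the arc the kernel is bounded, so the moments still dominate.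
\<close>

lemma kernel_integrable:
  assumes "away z"
  shows "(\<lambda>s. poly f (\<gamma> s) / (\<gamma> s - z) ^ n * (W s * \<gamma>' s)) integrable_on {0<..<1}"
proof -
  obtain d where d: "d > 0" "\<And>s. s \<in> {0<..<1} \<Longrightarrow> d \<le> norm (\<gamma> s - z)"
    using assms unfolding away_def by blast
  show ?thesis
  proof (rule integrable_if_poly_bounded[where C = "1 / d ^ n" and f = f])
    show "continuous_on {0<..<1} (\<lambda>s. poly f (\<gamma> s) / (\<gamma> s - z) ^ n)"
      using d by (intro continuous_intros cont_arc) fastforce
    show "norm (poly f (\<gamma> s) / (\<gamma> s - z) ^ n) \<le> 1 / d ^ n * norm (poly f (\<gamma> s))"
      if "s \<in> {0<..<1}" for s
    proof -
      have "d ^ n \<le> norm (\<gamma> s - z) ^ n" "0 < d ^ n" using d that by (auto intro: power_mono)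
      then show ?thesis by (auto simp: norm_divide norm_power intro!: divide_left_mono mult_pos_pos)
    qed
  qed
qed

lemma cauchy_integrable:
  assumes "away z"
  shows "(\<lambda>s. poly f (\<gamma> s) / (\<gamma> s - z) * (W s * \<gamma>' s)) integrable_on {0<..<1}"
  using kernel_integrable[OF assms, of f 1] by simp

lemma away_neq: "away z \<Longrightarrow> s \<in> {0<..<1} \<Longrightarrow> \<gamma> s \<noteq> z"
  unfolding away_def by force

lemma cauchy_add:
  assumes "away z"
  shows "cauchy (f + g) z = cauchy f z + cauchy g z"
  using Henstock_Kurzweil_Integration.integral_add
    [OF cauchy_integrable[OF assms, of f] cauchy_integrable[OF assms, of g]]
  unfolding cauchy_def arc_integral_def by (simp add: add_divide_distrib distrib_right)

lemma cauchy_smult: "cauchy (smult a f) z = a * cauchy f z"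
  unfolding cauchy_def arc_integral_def
  by (subst integral_mult_right[symmetric]) (simp add: mult_ac)

text \<open>
  From \<open>t / (t - z) = z / (t - z) + 1\<close>: multiplying the density by \<open>t\<close> multiplies the transform by
  \<open>z\<close> up to a constant. All polynomial corrections in the main argument come from this identity.
\<close>

lemma cauchy_pCons_0:
  assumes "away z"
  shows "cauchy (pCons 0 f) z = z * cauchy f z + arc_integral (\<lambda>s. poly f (\<gamma> s))"
proof -
  have "cauchy (pCons 0 f) z =
      integral {0<..<1} (\<lambda>s. z * (poly f (\<gamma> s) / (\<gamma> s - z) * (W s * \<gamma>' s))
                              + poly f (\<gamma> s) * (W s * \<gamma>' s))"
    unfolding cauchy_def arc_integral_def
  proof (rule Henstock_Kurzweil_Integration.integral_cong)
    fix s :: real assume "s \<in> {0<..<1}"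
    then have "\<gamma> s - z \<noteq> 0" using away_neq[OF assms] by simp
    then show "poly (pCons 0 f) (\<gamma> s) / (\<gamma> s - z) * (W s * \<gamma>' s) =
        z * (poly f (\<gamma> s) / (\<gamma> s - z) * (W s * \<gamma>' s)) + poly f (\<gamma> s) * (W s * \<gamma>' s)"
      by (simp add: divide_simps) (simp add: algebra_simps)
  qed
  also have "\<dots> = z * cauchy f z + arc_integral (\<lambda>s. poly f (\<gamma> s))"
    unfolding cauchy_def arc_integral_def
    by (simp only: Henstock_Kurzweil_Integration.integral_mult_right
        Henstock_Kurzweil_Integration.integral_add
        [OF integrable_on_mult_right[OF cauchy_integrable[OF assms]] poly_integrable])
  finally show ?thesis .
qed

lemma away_near:
  assumes "\<And>s. s \<in> {0<..<1} \<Longrightarrow> d \<le> norm (\<gamma> s - z)" and "norm h < d"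
  shows "\<And>s. s \<in> {0<..<1} \<Longrightarrow> d - norm h \<le> norm (\<gamma> s - (z + h))" and "away (z + h)"
proof -
  show *: "d - norm h \<le> norm (\<gamma> s - (z + h))" if "s \<in> {0<..<1}" for s
    using assms(1)[OF that] norm_triangle_ineq2[of "\<gamma> s - z" h] by (simp add: diff_diff_eq)
  show "away (z + h)" unfolding away_def
    using * assms(2) by (intro exI[of _ "d - norm h"]) auto
qed

lemma open_away: "open {z. away z}"
  unfolding open_dist
proof (intro ballI)
  fix z assume "z \<in> {z. away z}"
  then obtain d where d: "d > 0" "\<And>s. s \<in> {0<..<1} \<Longrightarrow> d \<le> norm (\<gamma> s - z)"
    unfolding away_def by blast
  have "away y" if "dist y z < d" for y
    using away_near(2)[of d z "y - z"] d(2) that by (simp add: dist_norm)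
  with d(1) show "\<exists>e>0. \<forall>y. dist y z < e \<longrightarrow> y \<in> {z. away z}" by blast
qed

lemma kernel_quotient:
  fixes a h c e :: complex
  assumes "a \<noteq> 0" "a - h \<noteq> 0" "h \<noteq> 0"
  shows "(c / (a - h) * e - c / a * e) / h - c / a\<^sup>2 * e = c * e * (h / (a\<^sup>2 * (a - h)))"
proof -
  have "(1 / (a - h) - 1 / a) / h - 1 / a\<^sup>2 = h / (a\<^sup>2 * (a - h))"
    using assms by (simp add: divide_simps power2_eq_square)
  from arg_cong[OF this, of "\<lambda>x. c * e * x"] show ?thesis
    by (simp add: algebra_simps diff_divide_distrib)
qed

text \<open>
  The difference quotient of the kernel \<open>1/(t - z)\<close> differs from \<open>1/(t - z)\<^sup>2\<close> by
  \<open>h / ((t - z)\<^sup>2 (t - z - h))\<close>, which is at most \<open>2 |h| / d\<^sup>3\<close> when \<open>|h| < d/2\<close>. This bound is uniform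
  along the arc, so arcs of infinite length cause no difficulty.
\<close>

lemma cauchy_has_field_derivative:
  assumes "away z"
  shows "(cauchy f has_field_derivative cauchy_deriv f z) (at z)"
proof -
  obtain d where d: "d > 0" "\<And>s. s \<in> {0<..<1} \<Longrightarrow> d \<le> norm (\<gamma> s - z)"
    using assms unfolding away_def by blast
  define M where "M = integral {0<..<1} (\<lambda>s. norm (poly f (\<gamma> s)) * norm (W s * \<gamma>' s))"
  have bound: "norm ((cauchy f (z + h) - cauchy f z) / h - cauchy_deriv f z) \<le> norm h * (2 / d ^ 3 * M)"
    if h: "h \<noteq> 0" "norm h < d / 2" for h
  proof -
    have near: "\<And>s. s \<in> {0<..<1} \<Longrightarrow> d - norm h \<le> norm (\<gamma> s - (z + h))" "away (z + h)"
      using away_near[of d z h] d h by auto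
    let ?q = "\<lambda>s. (poly f (\<gamma> s) / (\<gamma> s - (z + h)) * (W s * \<gamma>' s)
           - poly f (\<gamma> s) / (\<gamma> s - z) * (W s * \<gamma>' s)) / h
           - poly f (\<gamma> s) / (\<gamma> s - z)\<^sup>2 * (W s * \<gamma>' s)"
    note i = cauchy_integrable[OF near(2), of f] cauchy_integrable[OF assms, of f]
      kernel_integrable[OF assms, of f 2]
    have q: "?q integrable_on {0<..<1}"
      by (intro Henstock_Kurzweil_Integration.integrable_diff integrable_on_divide i)
    have quot: "(cauchy f (z + h) - cauchy f z) / h - cauchy_deriv f z = integral {0<..<1} ?q"
      unfolding cauchy_def cauchy_deriv_def arc_integral_def
      by (simp only: Henstock_Kurzweil_Integration.integral_divide
          Henstock_Kurzweil_Integration.integral_diff[OF i(1,2)]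
          Henstock_Kurzweil_Integration.integral_diff
            [OF integrable_on_divide[OF Henstock_Kurzweil_Integration.integrable_diff[OF i(1,2)]] i(3)])
    have qle: "norm (?q s) \<le> norm h * (2 / d ^ 3) * (norm (poly f (\<gamma> s)) * norm (W s * \<gamma>' s))"
      if s: "s \<in> {0<..<1}" for s
    proof -
      have n: "d \<le> norm (\<gamma> s - z)" "d / 2 \<le> norm (\<gamma> s - (z + h))"
        using d(2)[OF s] near(1)[OF s] h by auto
      then have nz: "\<gamma> s - z \<noteq> 0" "\<gamma> s - (z + h) \<noteq> 0" using d(1) by auto
      have eq: "?q s = poly f (\<gamma> s) * (W s * \<gamma>' s) * (h / ((\<gamma> s - z)\<^sup>2 * (\<gamma> s - (z + h))))"
        using kernel_quotient[of "\<gamma> s - z" h "poly f (\<gamma> s)" "W s * \<gamma>' s"] nz h(1)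
        by (simp add: diff_diff_eq)
      have bd: "norm (h / ((\<gamma> s - z)\<^sup>2 * (\<gamma> s - (z + h)))) \<le> norm h * (2 / d ^ 3)"
      proof -
        have "d\<^sup>2 * (d / 2) \<le> (norm (\<gamma> s - z))\<^sup>2 * norm (\<gamma> s - (z + h))"
          using n d(1) by (intro mult_mono power_mono) auto
        moreover have "0 < d\<^sup>2 * (d / 2)" using d(1) by simp
        ultimately have "norm h / ((norm (\<gamma> s - z))\<^sup>2 * norm (\<gamma> s - (z + h))) \<le> norm h / (d\<^sup>2 * (d / 2))"
          using n d(1) by (intro divide_left_mono mult_pos_pos zero_less_power) auto
        also have "\<dots> = norm h * (2 / d ^ 3)"
          by (simp add: power2_eq_square power3_eq_cube)
        finally show ?thesis by (simp add: norm_divide norm_mult norm_power)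
      qed
      show ?thesis
        unfolding eq norm_mult[of "poly f (\<gamma> s) * (W s * \<gamma>' s)"]
        using mult_left_mono[OF bd norm_ge_zero, of "poly f (\<gamma> s) * (W s * \<gamma>' s)"]
        by (simp only: norm_mult mult_ac)
    qed
    have "norm ((cauchy f (z + h) - cauchy f z) / h - cauchy_deriv f z)
        \<le> integral {0<..<1} (\<lambda>s. norm h * (2 / d ^ 3) * (norm (poly f (\<gamma> s)) * norm (W s * \<gamma>' s)))"
      unfolding quot
      by (rule Henstock_Kurzweil_Integration.integral_norm_bound_integral
          [OF q integrable_on_mult_right[OF poly_dominated] qle])
    also have "\<dots> = norm h * (2 / d ^ 3 * M)"
      unfolding M_def Henstock_Kurzweil_Integration.integral_mult_right by (rule mult.assoc)
    finally show ?thesis .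
  qed
  have "((\<lambda>h. (cauchy f (z + h) - cauchy f z) / h - cauchy_deriv f z) \<longlongrightarrow> 0) (at 0)"
  proof (rule Lim_null_comparison)
    show "\<forall>\<^sub>F h in at 0. norm ((cauchy f (z + h) - cauchy f z) / h - cauchy_deriv f z)
        \<le> norm h * (2 / d ^ 3 * M)"
      unfolding eventually_at using d(1) bound
      by (intro exI[of _ "d / 2"]) auto
    show "((\<lambda>h::complex. norm h * (2 / d ^ 3 * M)) \<longlongrightarrow> 0) (at 0)"
      by (intro tendsto_mult_left_zero tendsto_norm_zero tendsto_ident_at)
  qed
  then show ?thesis unfolding DERIV_def by (simp add: LIM_zero_iff)
qed


section \<open>Vanishing of the boundary terms\<close>

lemma end_neighbourhood:
  assumes F: "F \<in> {at_right 0, at_left (1::real)}" and P: "\<forall>\<^sub>F s in F. P s"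
  obtains p q where "p < q" "{p<..<q} \<subseteq> {0<..<1}" "\<forall>\<^sub>F s in F. s \<in> {p<..<q}"
    "\<And>s. s \<in> {p<..<q} \<Longrightarrow> P s"
  using F
proof (elim insertE emptyE)
  assume F0: "F = at_right 0"
  then obtain b where b: "b > 0" "\<And>s. 0 < s \<Longrightarrow> s < b \<Longrightarrow> P s"
    using P by (auto simp: eventually_at_right_field)
  show ?thesis
    by (rule that[of 0 "min b 1"])
       (use b F0 eventually_at_right_real[of 0 "min b 1"] in auto)
next
  assume F1: "F = at_left 1"
  then obtain b where b: "b < 1" "\<And>s. b < s \<Longrightarrow> s < 1 \<Longrightarrow> P s"
    using P by (auto simp: eventually_at_left_field)
  show ?thesis
    by (rule that[of "max b 0" 1])
       (use b F1 eventually_at_left_real[of "max b 0" 1] in auto)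
qed

lemma end_nontrivial: "F \<in> {at_right 0, at_left (1::real)} \<Longrightarrow> F \<noteq> bot"
  by (elim insertE emptyE) simp_all

text \<open>
  With \<open>v = A w\<close> and \<open>w'/w = B/A\<close> one has \<open>v' = (A' + B) w\<close>; the denominator \<open>A\<close> cancels, so the
  derivative of \<open>f v\<close> is a polynomial times \<open>w\<close> and is integrable.
\<close>

lemma v_derivative:
  assumes s: "s \<in> {0<..<1} - S"
  shows "((\<lambda>s. poly (A * f) (\<gamma> s) * W s) has_vector_derivative
     poly (A * pderiv f + (pderiv A + B) * f) (\<gamma> s) * (W s * \<gamma>' s)) (at s)"
proof -
  have nz: "poly A (\<gamma> s) \<noteq> 0" using avoids_zeros s by simp
  have "((\<lambda>s. poly (A * f) (\<gamma> s)) has_vector_derivative \<gamma>' s * poly (pderiv (A * f)) (\<gamma> s)) (at s)"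
    using field_vector_diff_chain_at[OF arc_derivative[OF s] poly_DERIV[of "A * f"]]
    unfolding o_def .
  from has_vector_derivative_mult[OF this weight_ode[OF s]] show ?thesis
    by (rule has_vector_derivative_eq_rhs) (use nz in \<open>simp add: pderiv_mult field_simps\<close>)
qed

lemma cont_v: "continuous_on {0<..<1} (\<lambda>s. poly f (\<gamma> s) * W s)"
  by (intro continuous_intros cont_weight)

lemma v_limits:
  assumes F: "F \<in> {at_right 0, at_left 1}"
  shows "\<exists>l. ((\<lambda>s. poly (A * f) (\<gamma> s) * W s) \<longlongrightarrow> l) F"
proof -
  from integrable_derivative_limits[OF zero_less_one finite_corners cont_v[of "A * f"]
      v_derivative[of _ f] poly_integrable]
  obtain l r where "((\<lambda>s. poly (A * f) (\<gamma> s) * W s) \<longlongrightarrow> l) (at_right 0)"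
      "((\<lambda>s. poly (A * f) (\<gamma> s) * W s) \<longlongrightarrow> r) (at_left 1)" by blast
  with F show ?thesis by blast
qed

text \<open>
  If \<open>\<gamma>\<close> tends to \<open>a\<close>, then \<open>ln |\<gamma> - a|\<^sup>2\<close> tends to \<open>-\<infinity>\<close>, while an integrable bound for
  \<open>|\<gamma>'| / |\<gamma> - a|\<close> would make its derivative integrable and hence keep it bounded.
\<close>

lemma not_log_integrable:
  assumes F: "F \<in> {at_right 0, at_left 1}" and lim: "(\<gamma> \<longlongrightarrow> a) F"
    and pq: "p < q" "{p<..<q} \<subseteq> {0<..<1}" "\<forall>\<^sub>F s in F. s \<in> {p<..<q}"
    and ne: "\<And>s. s \<in> {p<..<q} \<Longrightarrow> \<gamma> s \<noteq> a"
    and g: "g integrable_on {p<..<q}"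
    and le: "\<And>s. s \<in> {p<..<q} - S \<Longrightarrow> norm (\<gamma>' s) / norm (\<gamma> s - a) \<le> g s"
  shows False
proof -
  let ?h = "\<lambda>s. \<gamma> s - a"
  let ?u = "\<lambda>s. ln (?h s \<bullet> ?h s)"
  let ?u' = "\<lambda>s. 2 * (?h s \<bullet> \<gamma>' s) / (?h s \<bullet> ?h s)"
  have pos: "?h s \<bullet> ?h s > 0" if "s \<in> {p<..<q}" for s using ne[OF that] by simp
  have conth: "continuous_on {p<..<q} ?h"
    by (intro continuous_intros continuous_on_subset[OF cont_arc] pq)
  have cont: "continuous_on {p<..<q} ?u"
    using pos by (intro continuous_intros conth) (auto simp: less_imp_neq)
  have der: "(?u has_vector_derivative ?u' s) (at s)" if s: "s \<in> {p<..<q} - S" for s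
  proof -
    have "(?h has_vector_derivative \<gamma>' s) (at s)"
      using arc_derivative[of s] s pq(2) by (auto intro!: derivative_eq_intros)
    from has_real_derivative_inner_self[OF this] have "(?u has_real_derivative ?u' s) (at s)"
      using pos[of s] s by (auto intro!: derivative_eq_intros)
    then show ?thesis by (simp add: has_real_derivative_iff_has_vector_derivative)
  qed
  have "?u' absolutely_integrable_on {p<..<q}"
  proof (rule dominated_continuous_absolutely_integrable[OF finite_corners])
    show "continuous_on ({p<..<q} - S) ?u'"
      using pos by (intro continuous_intros continuous_on_subset[OF conth]
          continuous_on_subset[OF cont_tangent]) (use pq ne in auto)
    show "(\<lambda>s. 2 * g s) integrable_on {p<..<q}" by (intro integrable_on_mult_right g)
    show "norm (?u' s) \<le> 2 * g s" if s: "s \<in> {p<..<q} - S" for s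
    proof -
      have n: "norm (?h s) > 0" using ne[of s] s by simp
      have "norm (?u' s) = 2 * \<bar>?h s \<bullet> \<gamma>' s\<bar> / (norm (?h s))\<^sup>2"
        by (simp add: abs_mult power2_norm_eq_inner)
      also have "\<dots> \<le> 2 * (norm (?h s) * norm (\<gamma>' s)) / (norm (?h s))\<^sup>2"
        by (intro divide_right_mono mult_left_mono Cauchy_Schwarz_ineq2) auto
      also have "\<dots> = 2 * (norm (\<gamma>' s) / norm (?h s))"
        using n by (simp add: power2_eq_square)
      also have "\<dots> \<le> 2 * g s" using le[OF s] by simp
      finally show ?thesis .
    qed
  qed
  then have "?u' integrable_on {p<..<q}" by (rule set_lebesgue_integral_eq_integral(1))
  then have "bounded (?u ` {p<..<q})"
    using integrable_derivative_limits[OF pq(1) finite_corners cont der] by blast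
  then obtain M where M: "\<And>s. s \<in> {p<..<q} \<Longrightarrow> norm (?u s) \<le> M"
    unfolding bounded_iff by blast
  have "((\<lambda>s. ?h s \<bullet> ?h s) \<longlongrightarrow> 0) F"
    by (rule tendsto_eq_intros lim refl)+ simp
  moreover have "\<forall>\<^sub>F s in F. ?h s \<bullet> ?h s > 0"
    using pq(3) by eventually_elim (rule pos)
  ultimately have "filterlim (\<lambda>s. ?h s \<bullet> ?h s) (at_right 0) F"
    by (rule tendsto_imp_filterlim_at_right)
  then have "filterlim ?u at_bot F"
    by (rule filterlim_compose[OF ln_at_0])
  then have "\<forall>\<^sub>F s in F. ?u s \<le> - M - 1"
    unfolding filterlim_at_bot by blast
  with pq(3) have "\<forall>\<^sub>F s in F. False"
    by eventually_elim (use M in force)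
  then show False using end_nontrivial[OF F] by simp
qed

text \<open>
  The limit of \<open>v\<close> exists. If it were not 0, then \<open>|w|\<close> would be at least a constant times
  \<open>1 / |\<gamma> - a|\<close> near the endpoint, because \<open>a\<close> is a zero of \<open>A\<close>, and finiteness of the moment of
  order 0 would contradict the preceding lemma.
\<close>

lemma v_vanishes_at_zero:
  assumes F: "F \<in> {at_right 0, at_left 1}" and a: "poly A a = 0" "(\<gamma> \<longlongrightarrow> a) F"
  shows "((\<lambda>s. poly A (\<gamma> s) * W s) \<longlongrightarrow> 0) F"
proof -
  obtain l where l: "((\<lambda>s. poly A (\<gamma> s) * W s) \<longlongrightarrow> l) F"
    using v_limits[OF F, of 1] by auto
  have "l = 0"
  proof (rule ccontr)
    assume "l \<noteq> 0"
    obtain A1 where A1: "A = [:- a, 1:] * A1" using a(1) by (auto simp: poly_eq_0_iff_dvd elim: dvdE)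
    define C where "C = norm (poly A1 a) + 1"
    have "((\<lambda>s. poly A1 (\<gamma> s)) \<longlongrightarrow> poly A1 a) F" by (intro tendsto_intros a)
    from order_tendstoD(2)[OF tendsto_norm[OF this], of C]
    have e1: "\<forall>\<^sub>F s in F. norm (poly A1 (\<gamma> s)) < C" by (simp add: C_def)
    from order_tendstoD(1)[OF tendsto_norm[OF l], of "norm l / 2"] \<open>l \<noteq> 0\<close>
    have e2: "\<forall>\<^sub>F s in F. norm l / 2 < norm (poly A (\<gamma> s) * W s)" by simp
    obtain p q where pq: "p < q" "{p<..<q} \<subseteq> {0<..<1}" "\<forall>\<^sub>F s in F. s \<in> {p<..<q}"
      and P: "\<And>s. s \<in> {p<..<q} \<Longrightarrow> norm (poly A1 (\<gamma> s)) < C \<and> norm l / 2 < norm (poly A (\<gamma> s) * W s)"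
      using end_neighbourhood[OF F eventually_conj[OF e1 e2]] by metis
    \<comment> \<open>From \<open>|l|/2 < |A(\<gamma>) W| < |\<gamma> - a| C |W|\<close> one gets \<open>1/|\<gamma> - a| < c |W|\<close>.\<close>
    define c where "c = 2 * C / norm l"
    have "c \<ge> 0" by (simp add: c_def C_def)
    show False
    proof (rule not_log_integrable[OF F a(2) pq])
      show "\<gamma> s \<noteq> a" if "s \<in> {p<..<q}" for s using avoids_zeros a(1) pq(2) that by blast
      have "(\<lambda>s. norm (poly 1 (\<gamma> s)) * norm (W s * \<gamma>' s)) integrable_on {0<..<1}" by (rule poly_dominated)
      then have "(\<lambda>s. norm (W s * \<gamma>' s)) integrable_on {0..1}" by (simp add: integrable_on_open_interval_real)
      then have "(\<lambda>s. norm (W s * \<gamma>' s)) integrable_on {p..q}"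
        by (rule integrable_subinterval_real) (use pq in \<open>simp add: greaterThanLessThan_subseteq_greaterThanLessThan\<close>)
      then show "(\<lambda>s. c * norm (W s * \<gamma>' s)) integrable_on {p<..<q}"
        by (intro integrable_on_mult_right) (simp add: integrable_on_open_interval_real)
      show "norm (\<gamma>' s) / norm (\<gamma> s - a) \<le> c * norm (W s * \<gamma>' s)" if s: "s \<in> {p<..<q} - S" for s
      proof -
        have n: "norm (\<gamma> s - a) > 0" using avoids_zeros a(1) pq(2) s by auto
        have Af: "poly A (\<gamma> s) = (\<gamma> s - a) * poly A1 (\<gamma> s)" by (simp add: A1 left_diff_distrib)
        have "norm l / 2 < norm (\<gamma> s - a) * (norm (poly A1 (\<gamma> s)) * norm (W s))"
          using P[of s] s by (simp add: Af norm_mult mult_ac)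
        also have "\<dots> \<le> norm (\<gamma> s - a) * (C * norm (W s))"
          using P[of s] s by (intro mult_left_mono mult_right_mono) auto
        finally have "1 / norm (\<gamma> s - a) \<le> c * norm (W s)"
          using n \<open>l \<noteq> 0\<close> by (simp add: c_def field_simps)
        from mult_right_mono[OF this, of "norm (\<gamma>' s)"] show ?thesis by (simp add: norm_mult)
      qed
    qed
  qed
  with l show ?thesis by simp
qed

text \<open>
  At an end at infinity \<open>f v\<close> is the quotient of \<open>t f v\<close>, which has a finite limit as well, by \<open>t\<close>.
  At a finite end the polynomial \<open>f\<close> is bounded and \<open>v\<close> tends to 0.
\<close>

lemma v_vanishes:
  assumes F: "F \<in> {at_right 0, at_left 1}"
  shows "((\<lambda>s. poly (A * f) (\<gamma> s) * W s) \<longlongrightarrow> 0) F"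
  using ends[OF F]
proof
  assume inf: "filterlim \<gamma> at_infinity F"
  obtain l where l: "((\<lambda>s. poly (A * pCons 0 f) (\<gamma> s) * W s) \<longlongrightarrow> l) F"
    using v_limits[OF F] by blast
  have "((\<lambda>s. poly (A * pCons 0 f) (\<gamma> s) * W s / \<gamma> s) \<longlongrightarrow> 0) F"
    by (rule tendsto_divide_0[OF l inf])
  moreover have "\<forall>\<^sub>F s in F. poly (A * pCons 0 f) (\<gamma> s) * W s / \<gamma> s = poly (A * f) (\<gamma> s) * W s"
    using filterlim_at_infinity_imp_eventually_ne[OF inf, of 0] by eventually_elim simp
  ultimately show ?thesis by (rule Lim_transform_eventually)
next
  assume "\<exists>a. poly A a = 0 \<and> (\<gamma> \<longlongrightarrow> a) F"
  then obtain a where a: "poly A a = 0" "(\<gamma> \<longlongrightarrow> a) F" by blast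
  have "((\<lambda>s. poly f (\<gamma> s) * (poly A (\<gamma> s) * W s)) \<longlongrightarrow> poly f a * 0) F"
    by (intro tendsto_mult v_vanishes_at_zero[OF F a] tendsto_intros a)
  then show ?thesis by (simp add: mult_ac)
qed

text \<open>
  Integration by parts of \<open>f v / (t - z)\<close> along the arc. The boundary terms vanish because
  \<open>1/(t - z)\<close> is bounded on the arc, and the corners contribute nothing by continuity of the weight.
\<close>

lemma cauchy_deriv_A:
  assumes z: "away z"
  shows "cauchy_deriv (A * f) z = cauchy (A * pderiv f + (pderiv A + B) * f) z"
proof -
  obtain d where d: "d > 0" "\<And>s. s \<in> {0<..<1} \<Longrightarrow> d \<le> norm (\<gamma> s - z)"
    using z unfolding away_def by blast
  let ?g = "A * pderiv f + (pderiv A + B) * f"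
  let ?u = "\<lambda>s. poly (A * f) (\<gamma> s) * W s / (\<gamma> s - z)"
  let ?u' = "\<lambda>s. poly ?g (\<gamma> s) / (\<gamma> s - z) * (W s * \<gamma>' s)
      - poly (A * f) (\<gamma> s) / (\<gamma> s - z)\<^sup>2 * (W s * \<gamma>' s)"
  have ne: "\<gamma> s - z \<noteq> 0" if "s \<in> {0<..<1}" for s using away_neq[OF z that] by simp
  have cont: "continuous_on {0<..<1} ?u"
    using ne by (intro continuous_intros cont_v cont_arc) auto
  have alg: "v * (b * - (inverse x)\<^sup>2) + c * (e * b) * inverse x = c / x * (e * b) - p / x\<^sup>2 * (e * b)"
    if "v = p * e" for v p e b c x :: complex
    unfolding that by (simp add: divide_inverse power_inverse mult_ac)
  have der: "(?u has_vector_derivative ?u' s) (at s)" if s: "s \<in> {0<..<1} - S" for s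
  proof -
    have n: "\<gamma> s - z \<noteq> 0" using ne s by simp
    have "((\<lambda>t. inverse (t - z)) has_field_derivative - (inverse (\<gamma> s - z))\<^sup>2) (at (\<gamma> s))"
      using n by (auto intro!: derivative_eq_intros simp: power2_eq_square)
    from field_vector_diff_chain_at[OF arc_derivative[OF s] this]
    have "((\<lambda>s. inverse (\<gamma> s - z)) has_vector_derivative \<gamma>' s * - (inverse (\<gamma> s - z))\<^sup>2) (at s)"
      by (simp add: o_def)
    from has_vector_derivative_mult[OF v_derivative[OF s, of f] this]
    show ?thesis
      unfolding divide_inverse[of "poly (A * f) (\<gamma> _) * W _"] alg[OF refl] .
  qed
  note i1 = cauchy_integrable[OF z, of ?g] and i2 = kernel_integrable[OF z, of "A * f" 2]
  have int: "?u' integrable_on {0<..<1}"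
    by (rule Henstock_Kurzweil_Integration.integrable_diff[OF i1 i2])
  obtain l r where lr: "(?u \<longlongrightarrow> l) (at_right 0)" "(?u \<longlongrightarrow> r) (at_left 1)"
      "(?u' has_integral r - l) {0<..<1}"
    using integrable_derivative_limits[OF zero_less_one finite_corners cont der int] by blast
  have lim0: "(?u \<longlongrightarrow> 0) F" if F: "F \<in> {at_right 0, at_left 1}" for F
  proof (rule Lim_null_comparison)
    show "((\<lambda>s. norm (poly (A * f) (\<gamma> s) * W s) / d) \<longlongrightarrow> 0) F"
      using tendsto_divide[OF tendsto_norm[OF v_vanishes[OF F, of f]] tendsto_const, of d] d(1) by simp
    have "\<forall>\<^sub>F s in F. s \<in> {0<..<1}"
      using F eventually_at_right_real[of 0 1] eventually_at_left_real[of 0 1] by auto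
    then show "\<forall>\<^sub>F s in F. norm (?u s) \<le> norm (poly (A * f) (\<gamma> s) * W s) / d"
    proof eventually_elim
      case (elim s)
      show ?case unfolding norm_divide
        by (rule divide_left_mono) (use d(1) d(2)[OF elim] in \<open>auto intro!: mult_pos_pos\<close>)
    qed
  qed
  have "l = 0"
    using tendsto_unique[OF end_nontrivial lr(1) lim0] by simp
  moreover have "r = 0"
    using tendsto_unique[OF end_nontrivial lr(2) lim0] by simp
  ultimately have "integral {0<..<1} ?u' = 0" using lr(3) by (simp add: integral_unique)
  moreover have "integral {0<..<1} ?u' = cauchy ?g z - cauchy_deriv (A * f) z"
    unfolding cauchy_def cauchy_deriv_def arc_integral_def
    by (rule Henstock_Kurzweil_Integration.integral_diff[OF i1 i2])
  ultimately show ?thesis by simp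
qed

end

section \<open>Algebra of the Cauchy transforms of polynomials\<close>

text \<open>
  The rest of the argument is algebra. It uses a family of transforms \<open>C f\<close>, linear in the
  polynomial \<open>f\<close>, that satisfies the shift identity with a functional \<open>m\<close> (integration against the
  weight) and the integration by parts formula for the derivative \<open>C' f\<close>.
\<close>

locale cauchy_functional =
  fixes A B :: "complex poly" and C :: "complex poly \<Rightarrow> complex \<Rightarrow> complex"
    and C' :: "complex poly \<Rightarrow> complex \<Rightarrow> complex" and m :: "complex poly \<Rightarrow> complex"
    and D :: "complex set"
  assumes open_D: "open D"
    and C_add: "\<And>f g z. z \<in> D \<Longrightarrow> C (f + g) z = C f z + C g z"
    and C_smult: "\<And>a f z. z \<in> D \<Longrightarrow> C (smult a f) z = a * C f z"
    and C_shift: "\<And>f z. z \<in> D \<Longrightarrow> C (pCons 0 f) z = z * C f z + m f"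
    and m_0: "m 0 = 0"
    and C_deriv: "\<And>f z. z \<in> D \<Longrightarrow> (C f has_field_derivative C' f z) (at z)"
    and C_ibp: "\<And>f z. z \<in> D \<Longrightarrow> C' (A * f) z = C (A * pderiv f + (pderiv A + B) * f) z"
begin

lemma C_0: "z \<in> D \<Longrightarrow> C 0 z = 0"
  using C_smult[of z 0 0] by simp

text \<open>
  Iterating the shift identity over the coefficients of \<open>E\<close>. The correction \<open>Q\<close> is the integral of
  \<open>f(t) (E(t) - E(z)) / (t - z)\<close> against the weight, which explains its degree.
  For constant \<open>E\<close> it is 0; a strict bound on a natural number cannot say so, hence the first
  alternative.
\<close>

lemma C_mult:
  "\<exists>Q. (Q = 0 \<or> degree Q < degree E) \<and> (\<forall>z\<in>D. C (E * f) z = poly E z * C f z + poly Q z)"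
proof (induction E)
  case 0
  show ?case by (auto simp: C_0)
next
  case (pCons a E)
  then obtain Q where Q: "Q = 0 \<or> degree Q < degree E"
      "\<And>z. z \<in> D \<Longrightarrow> C (E * f) z = poly E z * C f z + poly Q z" by blast
  have "C (pCons a E * f) z = poly (pCons a E) z * C f z + poly (pCons (m (E * f)) Q) z" if "z \<in> D" for z
    using that by (simp add: C_add C_smult C_shift Q algebra_simps)
  moreover have "pCons (m (E * f)) Q = 0 \<or> degree (pCons (m (E * f)) Q) < degree (pCons a E)"
    using Q(1) by (cases "E = 0") (auto simp: m_0)
  ultimately show ?case by blast
qed

text \<open>
  The derivative of \<open>C (A P)\<close> is computed twice. Differentiating \<open>C (A P) = A C P + Q1\<close> produces
  \<open>A (C P)' + A' C P + Q1'\<close>; integration by parts produces \<open>C (A P' + A' P + B P)\<close>. Pulling \<open>A'\<close> and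
  \<open>B\<close> out of the transform leaves \<open>A (C P)' - B C P = C (A P')\<close> plus a polynomial. Division with
  remainder \<open>A P' = E P + U\<close> now gives \<open>C (A P') = E C P + C U\<close> plus a polynomial, and the multiple \<open>E\<close>
  of the first row of the determinant drops out.
\<close>

lemma D_decomposition:
  assumes "P \<noteq> 0"
  obtains U H where "U = 0 \<or> degree U < degree P"
    "degree H \<le> max (degree A - 2) (degree B - 1)"
    "\<And>z. z \<in> D \<Longrightarrow> poly P z * (poly A z * C' P z - poly B z * C P z) - poly A z * poly (pderiv P) z * C P z
        = poly P z * (C U z + poly H z) - poly U z * C P z"
proof -
  define E where "E = A * pderiv P div P"
  define U where "U = A * pderiv P mod P"
  have dec: "A * pderiv P = E * P + U" by (simp add: E_def U_def)
  have degU: "U = 0 \<or> degree U < degree P" unfolding U_def using assms by (rule degree_mod_less)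
  have degE: "degree E \<le> degree A - 1"
  proof (cases "E = 0 \<or> degree P = 0")
    case True
    then show ?thesis
    proof
      assume "degree P = 0"
      then have "pderiv P = 0" by (simp add: pderiv_eq_0_iff)
      then show ?thesis by (simp add: E_def)
    qed simp
  next
    case False
    then have "degree (E * P) = degree E + degree P" using assms by (simp add: degree_mult_eq)
    moreover have "degree (E * P + U) = degree (E * P)"
      using degU calculation by (cases "U = 0") (simp_all add: degree_add_eq_left)
    moreover have "degree (A * pderiv P) \<le> degree A + (degree P - 1)"
      using degree_mult_le[of A "pderiv P"] by (simp add: degree_pderiv)
    ultimately show ?thesis using dec False by simp
  qed
  obtain Q1 where Q1: "Q1 = 0 \<or> degree Q1 < degree A"
      "\<And>z. z \<in> D \<Longrightarrow> C (A * P) z = poly A z * C P z + poly Q1 z" using C_mult by metis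
  obtain Q2 where Q2: "Q2 = 0 \<or> degree Q2 < degree (pderiv A)"
      "\<And>z. z \<in> D \<Longrightarrow> C (pderiv A * P) z = poly (pderiv A) z * C P z + poly Q2 z" using C_mult by metis
  obtain Q3 where Q3: "Q3 = 0 \<or> degree Q3 < degree B"
      "\<And>z. z \<in> D \<Longrightarrow> C (B * P) z = poly B z * C P z + poly Q3 z" using C_mult by metis
  obtain Q4 where Q4: "Q4 = 0 \<or> degree Q4 < degree E"
      "\<And>z. z \<in> D \<Longrightarrow> C (E * P) z = poly E z * C P z + poly Q4 z" using C_mult by metis
  \<comment> \<open>\<open>Q1'\<close>, \<open>Q2\<close>, \<open>Q4\<close> have degree at most \<open>deg A - 2\<close>, and \<open>Q3\<close> at most \<open>deg B - 1\<close>.\<close>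
  define H where "H = Q4 + Q2 + Q3 - pderiv Q1"
  have degH: "degree H \<le> max (degree A - 2) (degree B - 1)"
    unfolding H_def using Q1(1) Q2(1) Q3(1) Q4(1) degE
    by (intro degree_diff_le degree_add_le) (auto simp: degree_pderiv le_max_iff_disj)
  have "poly A z * C' P z - poly B z * C P z = C U z + poly E z * C P z + poly H z" if z: "z \<in> D" for z
  proof -
    have "((\<lambda>z. poly A z * C P z + poly Q1 z) has_field_derivative
        poly (pderiv A) z * C P z + poly A z * C' P z + poly (pderiv Q1) z) (at z)"
      using z by (auto intro!: derivative_eq_intros C_deriv poly_DERIV)
    then have "(C (A * P) has_field_derivative
        poly (pderiv A) z * C P z + poly A z * C' P z + poly (pderiv Q1) z) (at z)"
      by (rule has_field_derivative_transform_within_open[OF _ open_D z]) (simp add: Q1)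
    with C_deriv[OF z] have "C' (A * P) z =
        poly (pderiv A) z * C P z + poly A z * C' P z + poly (pderiv Q1) z"
      by (rule DERIV_unique)
    moreover have "C' (A * P) z = C (E * P) z + C U z + C (pderiv A * P) z + C (B * P) z"
      using z by (simp add: C_ibp dec C_add distrib_right)
    ultimately show ?thesis
      unfolding Q2(2)[OF z] Q3(2)[OF z] Q4(2)[OF z] by (simp add: H_def algebra_simps)
  qed
  moreover have "poly A z * poly (pderiv P) z = poly E z * poly P z + poly U z" for z
    using arg_cong[OF dec, of "\<lambda>p. poly p z"] by simp
  ultimately have "poly P z * (poly A z * C' P z - poly B z * C P z) - poly A z * poly (pderiv P) z * C P z
        = poly P z * (C U z + poly H z) - poly U z * C P z" if "z \<in> D" for z
    using that by (simp add: algebra_simps)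
  with degU degH that show ?thesis by blast
qed

text \<open>
  Both \<open>P C U\<close> and \<open>U C P\<close> differ from \<open>C (P U)\<close> by a polynomial.
\<close>

lemma C_wronskian:
  assumes "U = 0 \<or> degree U < degree P"
  obtains R where "degree R \<le> degree P - 1" 
    "\<And>z. z \<in> D \<Longrightarrow> poly P z * C U z - poly U z * C P z = poly R z"
proof -
  obtain Q1 where Q1: "Q1 = 0 \<or> degree Q1 < degree P"
      "\<And>z. z \<in> D \<Longrightarrow> C (P * U) z = poly P z * C U z + poly Q1 z" using C_mult by metis
  obtain Q2 where Q2: "Q2 = 0 \<or> degree Q2 < degree U"
      "\<And>z. z \<in> D \<Longrightarrow> C (U * P) z = poly U z * C P z + poly Q2 z" using C_mult by metis
  have "degree (Q2 - Q1) \<le> degree P - 1"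
    using Q1(1) Q2(1) assms by (intro degree_diff_le) auto
  moreover have "poly P z * C U z - poly U z * C P z = poly (Q2 - Q1) z" if "z \<in> D" for z
    using Q1(2)[OF that] Q2(2)[OF that] by (simp add: mult.commute[of U P] algebra_simps)
  ultimately show ?thesis using that by blast
qed

end

section \<open>Semiclassical weights\<close>

lemma weighted_arc_of_semiclassical_weight:
  assumes A: "A \<noteq> 0" and jor: "jordan_piecewise_analytic_arc \<gamma>"
    and join: "joins_points_of (zeros A) \<gamma>" and int: "arc_interior \<gamma> \<inter> zeros A = {}"
    and wt: "semiclassical_weight_on A B \<gamma> w"
    and mom: "\<And>m. (\<lambda>s. norm (\<gamma> s) ^ m * norm (w (\<gamma> s)) * norm (vector_derivative \<gamma> (at s)))
          integrable_on {0<..<1}"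
  shows "\<exists>S. weighted_arc A B \<gamma> (\<lambda>s. vector_derivative \<gamma> (at s)) (\<lambda>s. w (\<gamma> s)) S"
proof -
  obtain S where S: "finite S" and
    reg: "\<And>a b. 0 < a \<Longrightarrow> a < b \<Longrightarrow> b < 1 \<Longrightarrow> {a<..<b} \<inter> S = {} \<Longrightarrow> regular_analytic_on \<gamma> {a..b}"
    using jor unfolding jordan_piecewise_analytic_arc_def by blast
  have nz: "poly A (\<gamma> s) \<noteq> 0" if "s \<in> {0<..<1}" for s
    using int that by (fastforce simp: arc_interior_def zeros_def)
  have local: "\<exists>a b. a < s \<and> s < b \<and> {a<..<b} \<subseteq> {0<..<1} \<and> regular_analytic_on \<gamma> {a..b}"
    if s: "s \<in> {0<..<1} - S" for s
  proof -
    have "open ({0<..<1} - S)" using S by (simp add: open_Diff finite_imp_closed)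
    then obtain e where e: "e > 0" "cball s e \<subseteq> {0<..<1} - S"
      using s open_contains_cball by blast
    have sub: "{s - e..s + e} \<subseteq> {0<..<1} - S" using e(2) by (simp add: cball_eq_atLeastAtMost)
    have "s - e \<in> {0<..<1}" "s + e \<in> {0<..<1}"
      using e(1) by (auto intro!: subsetD[OF sub, THEN DiffD1] simp del: greaterThanLessThan_iff)
    moreover have "{s - e<..<s + e} \<subseteq> {0<..<1} - S"
      using greaterThanLessThan_subseteq_atLeastAtMost_iff sub by fastforce
    ultimately show ?thesis using e(1)
      by (intro exI[of _ "s - e"] exI[of _ "s + e"] conjI reg) auto
  qed
  show ?thesis
  proof (intro exI[of _ S] weighted_arc.intro)
    show "continuous_on {0<..<1} \<gamma>" using jor by (simp add: jordan_piecewise_analytic_arc_def)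
    show "continuous_on {0<..<1} (\<lambda>s. w (\<gamma> s))" using wt by (simp add: semiclassical_weight_on_def)
    show "continuous_on ({0<..<1} - S) (\<lambda>s. vector_derivative \<gamma> (at s))"
    proof (rule continuous_at_imp_continuous_on, rule ballI)
      fix s assume "s \<in> {0<..<1} - S"
      then obtain a b where "a < s" "s < b" "regular_analytic_on \<gamma> {a..b}" using local by blast
      with regular_analytic_on_derivative(2)[OF this(3)]
      show "isCont (\<lambda>s. vector_derivative \<gamma> (at s)) s"
        by (simp add: continuous_on_eq_continuous_at)
    qed
    show "(\<gamma> has_vector_derivative vector_derivative \<gamma> (at s)) (at s)" if s: "s \<in> {0<..<1} - S" for s
    proof -
      obtain a b where "a < s" "s < b" "regular_analytic_on \<gamma> {a..b}" using local[OF s] by blast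
      with regular_analytic_on_derivative(1)[OF this(3)] show ?thesis by simp
    qed
    show "((\<lambda>s. w (\<gamma> s)) has_vector_derivative
        poly B (\<gamma> s) / poly A (\<gamma> s) * vector_derivative \<gamma> (at s) * w (\<gamma> s)) (at s)"
      if s: "s \<in> {0<..<1} - S" for s
    proof -
      obtain a b where "a < s" "s < b" "{a<..<b} \<subseteq> {0<..<1}" "regular_analytic_on \<gamma> {a..b}"
        using local[OF s] by blast
      then show ?thesis using weight_derivative[OF wt] nz[of s] s by blast
    qed
    show "filterlim \<gamma> at_infinity F \<or> (\<exists>a. poly A a = 0 \<and> (\<gamma> \<longlongrightarrow> a) F)"
      if "F \<in> {at_right 0, at_left 1}" for F
      using join that by (auto simp: joins_points_of_def zeros_def)
  qed (use S nz mom in auto)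
qed

text \<open>
  The arc stays away from \<open>z\<close> near each end, whether that end is finite or at infinity, and the
  remaining parameters form a compact interval.
\<close>

lemma dist_arc_pos:
  assumes "jordan_piecewise_analytic_arc \<gamma>" and join: "joins_points_of Z \<gamma>" and z: "z \<notin> arc_trace \<gamma>"
  shows "\<exists>d>0. \<forall>s\<in>{0<..<1}. d \<le> norm (\<gamma> s - z)"
proof -
  have cont: "continuous_on {0<..<1} \<gamma>"
    using assms(1) by (simp add: jordan_piecewise_analytic_arc_def)
  have far: "\<exists>d>0. \<forall>\<^sub>F s in F. d \<le> norm (\<gamma> s - z)"
    if "filterlim \<gamma> at_infinity F \<or> (\<exists>a\<in>finite_ends \<gamma>. (\<gamma> \<longlongrightarrow> a) F)" for F
    using that
  proof
    assume "filterlim \<gamma> at_infinity F"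
    then have "filterlim (\<lambda>s. norm (\<gamma> s + - z)) at_top F"
      using tendsto_add_filterlim_at_infinity' tendsto_const filterlim_at_infinity_imp_norm_at_top by blast
    then have "\<forall>\<^sub>F s in F. 1 \<le> norm (\<gamma> s + - z)" by (simp add: filterlim_at_top)
    then show ?thesis by (intro exI[of _ 1]) simp
  next
    assume "\<exists>a\<in>finite_ends \<gamma>. (\<gamma> \<longlongrightarrow> a) F"
    then obtain a where a: "a \<in> finite_ends \<gamma>" "(\<gamma> \<longlongrightarrow> a) F" by blast
    have "a \<noteq> z" using a z by (auto simp: arc_trace_def)
    then have "norm (a - z) / 2 < norm (a - z)" by simp
    from order_tendstoD(1)[OF tendsto_norm[OF tendsto_diff[OF a(2) tendsto_const]] this]
    have "\<forall>\<^sub>F s in F. norm (a - z) / 2 \<le> norm (\<gamma> s - z)" by (rule eventually_mono) simp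
    then show ?thesis using \<open>a \<noteq> z\<close> by (intro exI[of _ "norm (a - z) / 2"]) simp
  qed
  obtain d0 where d0: "d0 > 0" "\<forall>\<^sub>F s in at_right 0. d0 \<le> norm (\<gamma> s - z)"
    using far[of "at_right 0"] join by (auto simp: joins_points_of_def finite_ends_def)
  then obtain p where p: "p > 0" "\<And>s. 0 < s \<Longrightarrow> s < p \<Longrightarrow> d0 \<le> norm (\<gamma> s - z)"
    by (auto simp: eventually_at_right_field)
  obtain d1 where d1: "d1 > 0" "\<forall>\<^sub>F s in at_left 1. d1 \<le> norm (\<gamma> s - z)"
    using far[of "at_left 1"] join by (auto simp: joins_points_of_def finite_ends_def)
  then obtain q where q: "q < 1" "\<And>s. q < s \<Longrightarrow> s < 1 \<Longrightarrow> d1 \<le> norm (\<gamma> s - z)"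
    by (auto simp: eventually_at_left_field)
  \<comment> \<open>The bounds by 1/2 keep \<open>K\<close> nonempty and inside the open interval if \<open>q < p\<close>, or \<open>p \<ge> 1\<close>, or \<open>q \<le> 0\<close>.\<close>
  define K where "K = {min p (1/2)..max q (1/2)}"
  have "K \<noteq> {}" "compact K" "K \<subseteq> {0<..<1}" using p(1) q(1) by (auto simp: K_def)
  moreover from this have "continuous_on K (\<lambda>s. norm (\<gamma> s - z))"
    by (intro continuous_intros continuous_on_subset[OF cont])
  ultimately obtain t where t: "t \<in> K" "\<And>s. s \<in> K \<Longrightarrow> norm (\<gamma> t - z) \<le> norm (\<gamma> s - z)"
    using continuous_attains_inf[of K] by blast
  have "\<gamma> t \<noteq> z" using t(1) \<open>K \<subseteq> {0<..<1}\<close> z by (auto simp: arc_trace_def arc_interior_def)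
  define d where "d = min (min d0 d1) (norm (\<gamma> t - z))"
  have "d > 0" using d0(1) d1(1) \<open>\<gamma> t \<noteq> z\<close> by (simp add: d_def)
  moreover have "d \<le> norm (\<gamma> s - z)" if s: "s \<in> {0<..<1}" for s
  proof -
    consider "s < p" | "q < s" | "s \<in> K" by (force simp: K_def)
    then show ?thesis
      by cases (use p(2)[of s] q(2)[of s] t(2)[of s] s in \<open>auto simp: d_def\<close>)
  qed
  ultimately show ?thesis by blast
qed

lemma det2_eq: "det2 a b c d = a * d - b * c"
  by (simp add: det2_def det_2 vector_def)

theorem theorem3p3:
  fixes A B P :: "complex poly" and k N :: nat
    and \<Gamma> :: "nat \<Rightarrow> real \<Rightarrow> complex" and w :: "complex \<Rightarrow> complex"
  assumes "lead_coeff A = 1"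
    and "1 \<le> k"
    and "admissible_arcs A k \<Gamma>"
    and "\<And>j. j \<in> {1..k} \<Longrightarrow> semiclassical_weight_on A B (\<Gamma> j) w"
    and "finite_moments k \<Gamma> w"
    and "0 \<le> class_index A B"
    and "P \<noteq> 0" and "degree P = N"
  shows "(\<exists>U H :: complex poly.
            (U = 0 \<or> int (degree U) \<le> int N - 1) \<and>
            int (degree H) \<le> class_index A B \<and>
            (\<forall>z. z \<notin> support k \<Gamma> \<longrightarrow>
               D_op A B k \<Gamma> w P z =
                 det2 (poly P z) (weighted_cauchy k \<Gamma> w (poly P) z)
                      (poly U z) (weighted_cauchy k \<Gamma> w (poly U) z + poly H z))) \<and>
         (\<exists>Q :: complex poly.
            int (degree Q) \<le> int N + class_index A B \<and>
            (\<forall>z. z \<notin> support k \<Gamma> \<longrightarrow> D_op A B k \<Gamma> w P z = poly Q z))"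
proof -
  have "A \<noteq> 0" using assms(1) by auto
  have adm: "jordan_piecewise_analytic_arc (\<Gamma> j)" "joins_points_of (zeros A) (\<Gamma> j)"
      "arc_interior (\<Gamma> j) \<inter> zeros A = {}" if "j \<in> {1..k}" for j
    using assms(3) that by (auto simp: admissible_arcs_def)
  have mom: "(\<lambda>s. norm (\<Gamma> j s) ^ m * norm (w (\<Gamma> j s)) * norm (vector_derivative (\<Gamma> j) (at s)))
          integrable_on {0<..<1}" if "j \<in> {1..k}" for j m
    using assms(5) that by (simp add: finite_moments_def)
  have "\<exists>S. weighted_arc A B (\<Gamma> j) (\<lambda>s. vector_derivative (\<Gamma> j) (at s)) (\<lambda>s. w (\<Gamma> j s)) S"
    if "j \<in> {1..k}" for j
    using weighted_arc_of_semiclassical_weight[OF \<open>A \<noteq> 0\<close> adm[OF that] assms(4)[OF that] mom[OF that]] .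
  then obtain S where arcs: "\<And>j. j \<in> {1..k} \<Longrightarrow>
      weighted_arc A B (\<Gamma> j) (\<lambda>s. vector_derivative (\<Gamma> j) (at s)) (\<lambda>s. w (\<Gamma> j s)) (S j)"
    by metis
  let ?T = "\<lambda>j s. vector_derivative (\<Gamma> j) (at s)" and ?W = "\<lambda>j s. w (\<Gamma> j s)"
  define D where "D = {z. \<forall>j\<in>{1..k}. weighted_arc.away (\<Gamma> j) z}"
  define C where "C f z = weighted_cauchy k \<Gamma> w (poly f) z" for f z
  define C' where "C' f z = (\<Sum>j\<in>{1..k}. weighted_arc.cauchy_deriv (\<Gamma> j) (?T j) (?W j) f z)" for f z
  define m where "m f = (\<Sum>j\<in>{1..k}. weighted_arc.arc_integral (?T j) (?W j) (\<lambda>s. poly f (\<Gamma> j s)))" for f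
  have C_eq: "C f z = (\<Sum>j\<in>{1..k}. weighted_arc.cauchy (\<Gamma> j) (?T j) (?W j) f z)" for f z
    unfolding C_def weighted_cauchy_def
  proof (rule sum.cong[OF refl])
    fix j assume "j \<in> {1..k}"
    then interpret weighted_arc A B "\<Gamma> j" "?T j" "?W j" "S j" by (rule arcs)
    show "contour_integral (\<Gamma> j) (\<lambda>t. poly f t * w t / (t - z)) = cauchy f z"
      unfolding contour_integral_integral integral_open_interval_real cauchy_def arc_integral_def
      by (simp add: mult_ac)
  qed
  interpret cauchy_functional A B C C' m D
  proof
    have "D = (\<Inter>j\<in>{1..k}. {z. weighted_arc.away (\<Gamma> j) z})" by (auto simp: D_def)
    then show "open D" using weighted_arc.open_away[OF arcs] by auto
    fix f g z a assume z: "z \<in> D"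
    show "C (f + g) z = C f z + C g z"
      unfolding C_eq sum.distrib[symmetric]
      by (intro sum.cong refl weighted_arc.cauchy_add[OF arcs]) (use z in \<open>auto simp: D_def\<close>)
    show "C (smult a f) z = a * C f z"
      unfolding C_eq sum_distrib_left
      by (intro sum.cong refl weighted_arc.cauchy_smult[OF arcs])
    show "C (pCons 0 f) z = z * C f z + m f"
      unfolding C_eq m_def sum_distrib_left sum.distrib[symmetric]
      by (intro sum.cong refl weighted_arc.cauchy_pCons_0[OF arcs]) (use z in \<open>auto simp: D_def\<close>)
    show "(C f has_field_derivative C' f z) (at z)"
      unfolding C_eq[abs_def] C'_def
      by (intro DERIV_sum weighted_arc.cauchy_has_field_derivative[OF arcs]) (use z in \<open>auto simp: D_def\<close>)
    show "C' (A * f) z = C (A * pderiv f + (pderiv A + B) * f) z"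
      unfolding C_eq C'_def
      by (intro sum.cong refl weighted_arc.cauchy_deriv_A[OF arcs]) (use z in \<open>auto simp: D_def\<close>)
  next
    show "m 0 = 0"
      unfolding m_def by (intro sum.neutral ballI) (simp add: weighted_arc.arc_integral_def[OF arcs])
  qed
  have D: "z \<in> D" if "z \<notin> support k \<Gamma>" for z
    unfolding D_def
  proof (intro CollectI ballI)
    fix j assume j: "j \<in> {1..k}"
    show "weighted_arc.away (\<Gamma> j) z"
      unfolding weighted_arc.away_def[OF arcs[OF j]]
      using dist_arc_pos[OF adm(1,2)[OF j]] that j by (auto simp: support_def)
  qed
  \<comment> \<open>As the class index is nonnegative, truncated subtraction does not change the maximum.\<close>
  have idx: "class_index A B = int (max (degree A - 2) (degree B - 1))"
    using assms(6) unfolding class_index_def by linarith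
  obtain U H where U: "U = 0 \<or> degree U < degree P"
    and H: "degree H \<le> max (degree A - 2) (degree B - 1)"
    and main: "\<And>z. z \<in> D \<Longrightarrow> poly P z * (poly A z * C' P z - poly B z * C P z)
        - poly A z * poly (pderiv P) z * C P z = poly P z * (C U z + poly H z) - poly U z * C P z"
    using D_decomposition[OF \<open>P \<noteq> 0\<close>] by metis
  have D_op_eq: "D_op A B k \<Gamma> w P z = poly P z * (C U z + poly H z) - poly U z * C P z"
    if z: "z \<notin> support k \<Gamma>" for z
  proof -
    have "deriv (C P) z = C' P z" using C_deriv[OF D[OF z]] by (rule DERIV_imp_deriv)
    then show ?thesis
      using main[OF D[OF z]]
      unfolding D_op_def Let_def det2_eq C_def[abs_def] by (simp add: mult_ac)
  qed
  obtain R where R: "degree R \<le> degree P - 1"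
      "\<And>z. z \<in> D \<Longrightarrow> poly P z * C U z - poly U z * C P z = poly R z"
    using C_wronskian[OF U] by metis
  show ?thesis
  proof (intro conjI exI allI impI)
    show "U = 0 \<or> int (degree U) \<le> int N - 1" using U assms(8) by auto
    show "int (degree H) \<le> class_index A B" unfolding idx using H by simp
    show "D_op A B k \<Gamma> w P z = det2 (poly P z) (weighted_cauchy k \<Gamma> w (poly P) z)
        (poly U z) (weighted_cauchy k \<Gamma> w (poly U) z + poly H z)" if "z \<notin> support k \<Gamma>" for z
      using D_op_eq[OF that] by (simp add: det2_eq C_def mult_ac)
    have "degree (R + P * H) \<le> degree P + max (degree A - 2) (degree B - 1)"
      using R(1) H degree_mult_le[of P H] by (intro degree_add_le) auto
    then show "int (degree (R + P * H)) \<le> int N + class_index A B"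
      unfolding idx using assms(8) by simp
    show "D_op A B k \<Gamma> w P z = poly (R + P * H) z" if "z \<notin> support k \<Gamma>" for z
      using D_op_eq[OF that] R(2)[OF D[OF that]] by (simp add: algebra_simps)
  qed
qed

end
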